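(* For $\epsilon,t>0$ let $\tau^\epsilon(t)=\inf\{x\in\mathbb{R}:X_t([x,\infty))<\epsilon\}\in[-\infty,\infty)$. There is a non-increasing function $c:(0,\infty)\to(0,\infty)$ such that for all $t,\epsilon>0$ and $u>0$: (a) for any finite Borel measure $X_0$ on $\mathbb{R}$, $$E^X_{X_0}\Bigl(\int_{\tau^\epsilon(t)-u}^\infty X(t,x)\,dx\Bigr)\le c(t)\,X_0(1)\,(u^2\vee\epsilon);$$ (b) $$\int\Bigl(\int_{\tau^\epsilon(t)-u}^\infty X(t,x)\,dx\Bigr)\,d\mathbb{N}_0\le c(t)\,(u^2\vee\epsilon).$$
   Context: Super-Brownian motion. $\mathcal{M}_F(\mathbb{R})$ is the space of finite Borel measures on $\mathbb{R}$ with the weak topology; $\mu(\phi)=\int\phi\,d\mu$, so $X_0(1)$ is the total mass of $X_0$. For bounded Borel $\phi\ge0$ let $V^\phi_t(x)$ be the unique non-negative solution of $V_t=S_t\phi-\int_0^tS_{t-s}(V_s^2/2)\,ds$, where $(S_t)$ is the semigroup of standard one-dimensional Brownian motion. Under $P^X_{X_0}$ (expectation $E^X_{X_0}$), $X=(X_t)_{t\ge0}$ is one-dimensional super-Brownian motion with branching rate one started at $X_0\in\mathcal{M}_F(\mathbb{R})$: the continuous $\mathcal{M}_F(\mathbb{R})$-valued Markov process whose transition laws satisfy $E^X_{X_0}(e^{-X_t(\phi)})=e^{-X_0(V^\phi_t)}$. $\mathbb{N}_x$ is the canonical measure of super-Brownian motion from $x$: the $\sigma$-finite measure on $C([0,\infty),\mathcal{M}_F(\mathbb{R}))$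 (not charging the zero path) such that, if $\Xi$ is a Poisson point process with intensity $\int\mathbb{N}_x(\cdot)\,X_0(dx)$, then $t\mapsto\int\nu_t\,\Xi(d\nu)$ for $t>0$, with value $X_0$ at $t=0$, is a super-Brownian motion with law $P^X_{X_0}$; in particular $\mathbb{N}_x(1-e^{-X_t(\phi)})=V^\phi_t(x)$ for $t>0$. Under $P^X_{X_0}$ and $\mathbb{N}_0$, $X_t(dx)=X(t,x)\,dx$ for all $t>0$ with $X(t,x)$ jointly continuous on $(0,\infty)\times\mathbb{R}$. Convention: if $X_t(\mathbb{R})<\epsilon$ then $\tau^\epsilon(t)=-\infty$, and then $\tau^\epsilon(t)-u=-\infty$. *)

theory Defs
  imports "HOL-Probability.Probability"
begin

subsection \<open>Finite measures on the line and the path space\<close>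

definition finite_borel_measures :: "real measure set" where
  "finite_borel_measures = {\<mu>. sets \<mu> = sets borel \<and> finite_measure \<mu>}"

definition weak_topology :: "real measure topology" where
  "weak_topology = topology_generated_by
     {{\<mu> \<in> finite_borel_measures. (LINT x|\<mu>. \<phi> x) \<in> U} | \<phi> U.
        continuous_on UNIV \<phi> \<and> bounded (range \<phi>) \<and> open (U :: real set)}"

definition weak_borel :: "real measure measure" where
  "weak_borel = sigma finite_borel_measures {U. openin weak_topology U}"

type_synonym path = "real \<Rightarrow> real measure"

text \<open>Paths are indexed by \<open>[0,\<infinity>)\<close>; off this set they take the value \<open>undefined\<close>, so that
  a path is determined by its values at the times \<open>t \<ge> 0\<close>. The \<open>\<sigma>\<close>-algebra on the path space is
  the one generated by the coordinate maps.\<close>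

definition continuous_paths :: "path set" where
  "continuous_paths =
     {\<omega> \<in> extensional {0..}. continuous_map (top_of_set {0..}) weak_topology \<omega>}"

definition path_space :: "path measure" where
  "path_space = restrict_space (PiM {0..} (\<lambda>_. weak_borel)) continuous_paths"

definition zero_path :: path where
  "zero_path = (\<lambda>t\<in>{0..}. null_measure borel)"


subsection \<open>The log-Laplace equation\<close>

definition heat_semigroup :: "real \<Rightarrow> (real \<Rightarrow> real) \<Rightarrow> real \<Rightarrow> real" where
  "heat_semigroup t f x =
     (if t = 0 then f x else LINT y|lborel. normal_density x (sqrt t) y * f y)"

text \<open>A solution satisfies \<open>0 \<le> V\<^sub>t \<le> S\<^sub>t \<phi>\<close>, because the integral below is non-negative. It is
  therefore bounded, and the Bochner integrals below do not take their default value \<open>0\<close>.\<close>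

definition log_laplace_solution :: "(real \<Rightarrow> real) \<Rightarrow> (real \<Rightarrow> real \<Rightarrow> real) \<Rightarrow> bool" where
  "log_laplace_solution \<phi> V \<longleftrightarrow>
     (\<lambda>(t, x). V t x) \<in> borel_measurable (restrict_space borel ({0..} \<times> UNIV)) \<and>
     (\<forall>t\<ge>0. \<forall>x. 0 \<le> V t x \<and>
        V t x = heat_semigroup t \<phi> x -
          (LINT s:{0..t}|lborel. heat_semigroup (t - s) (\<lambda>y. (V s y)\<^sup>2 / 2) x))"

definition test_function :: "(real \<Rightarrow> real) \<Rightarrow> bool" where
  "test_function \<phi> \<longleftrightarrow> \<phi> \<in> borel_measurable borel \<and> bounded (range \<phi>) \<and> (\<forall>x. 0 \<le> \<phi> x)"


subsection \<open>Super-Brownian motion\<close>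

text \<open>For every test function, the solution \<open>V\<close> of the log-Laplace equation is unique on
  \<open>[0,\<infinity>) \<times> \<real>\<close>, so the existential quantifier only names \<open>V\<^sup>\<phi>\<close>.\<close>

definition super_brownian_transition :: "(real \<Rightarrow> real measure \<Rightarrow> real measure measure) \<Rightarrow> bool" where
  "super_brownian_transition Q \<longleftrightarrow>
     (\<forall>t\<ge>0. Q t \<in> weak_borel \<rightarrow>\<^sub>M prob_algebra weak_borel) \<and>
     (\<forall>\<phi>. test_function \<phi> \<longrightarrow> (\<exists>V. log_laplace_solution \<phi> V \<and>
        (\<forall>t\<ge>0. \<forall>\<mu>\<in>finite_borel_measures.
           (LINT \<nu>|Q t \<mu>. exp (- (LINT x|\<nu>. \<phi> x))) = exp (- (LINT x|\<mu>. V t x)))))"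

definition past :: "path measure \<Rightarrow> real \<Rightarrow> path measure" where
  "past P s = vimage_algebra (space P) (\<lambda>\<omega>. restrict \<omega> {0..s}) (PiM {0..s} (\<lambda>_. weak_borel))"

definition super_brownian_law :: "real measure \<Rightarrow> path measure \<Rightarrow> bool" where
  "super_brownian_law X0 P \<longleftrightarrow>
     prob_space P \<and> sets P = sets path_space \<and> (AE \<omega> in P. \<omega> 0 = X0) \<and>
     (\<exists>Q. super_brownian_transition Q \<and>
        (\<forall>s\<ge>0. \<forall>t\<ge>0. \<forall>B\<in>sets weak_borel.
           AE \<omega> in P. real_cond_exp P (past P s) (\<lambda>\<omega>. indicator B (\<omega> (s + t))) \<omega>
             = measure (Q t (\<omega> s)) B))"


subsection \<open>Poisson point processes and the canonical measures\<close>

definition poisson_point_process ::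
    "'w measure \<Rightarrow> ('w \<Rightarrow> 'e measure) \<Rightarrow> 'e measure \<Rightarrow> bool" where
  "poisson_point_process W \<Xi> I \<longleftrightarrow>
     prob_space W \<and>
     (\<forall>w\<in>space W. sets (\<Xi> w) = sets I \<and>
        (\<forall>A\<in>sets I. emeasure (\<Xi> w) A \<in> insert \<infinity> (range of_nat))) \<and>
     (\<forall>A\<in>sets I. (\<lambda>w. emeasure (\<Xi> w) A) \<in> borel_measurable W) \<and>
     (\<forall>A\<in>sets I. emeasure I A < \<infinity> \<longrightarrow>
        (\<forall>n::nat. measure W {w \<in> space W. emeasure (\<Xi> w) A = of_nat n}
           = measure I A ^ n / fact n * exp (- measure I A))) \<and>
     (\<forall>A\<in>sets I. emeasure I A = \<infinity> \<longrightarrow> (AE w in W. emeasure (\<Xi> w) A = \<infinity>)) \<and>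
     (\<forall>\<A>. finite \<A> \<and> \<A> \<subseteq> sets I \<and> disjoint \<A> \<longrightarrow>
        prob_space.indep_vars W (\<lambda>_. borel) (\<lambda>A w. emeasure (\<Xi> w) A) \<A>)"

text \<open>The measure \<open>\<integral> \<kappa>(x, \<cdot>) \<mu>(dx)\<close> on the measurable space of \<open>S\<close>, for a kernel \<open>\<kappa>\<close> of
  measures that need not be sub-probabilities.\<close>

definition mixture :: "'a measure \<Rightarrow> ('a \<Rightarrow> 'b measure) \<Rightarrow> 'b measure \<Rightarrow> 'b measure" where
  "mixture \<mu> \<kappa> S = measure_of (space S) (sets S) (\<lambda>A. \<integral>\<^sup>+x. emeasure (\<kappa> x) A \<partial>\<mu>)"

definition superposition :: "real measure \<Rightarrow> path measure \<Rightarrow> path" where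
  "superposition X0 \<Xi> = (\<lambda>t\<in>{0..}. if t = 0 then X0 else mixture \<Xi> (\<lambda>\<nu>. \<nu> t) borel)"

text \<open>The superposition is a continuous path of finite measures only almost surely, so its law is
  that of a path-valued random variable \<open>Y\<close> equal to it almost surely. The point processes are
  defined on probability spaces of type \<^typ>\<open>path measure measure\<close>; this is no restriction, as it
  includes the space of point measures on the path space, where \<open>\<Xi>\<close> can be the identity. The last
  clause is a consequence of the preceding ones.\<close>

definition canonical_measures :: "(real \<Rightarrow> path measure) \<Rightarrow> bool" where
  "canonical_measures N \<longleftrightarrow>
     (\<forall>x. sets (N x) = sets path_space \<and> sigma_finite_measure (N x) \<and>
        (AE \<nu> in N x. \<nu> \<noteq> zero_path)) \<and>
     (\<forall>A\<in>sets path_space. (\<lambda>x. emeasure (N x) A) \<in> borel_measurable borel) \<and>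
     (\<forall>X0\<in>finite_borel_measures. \<forall>(W :: path measure measure) \<Xi>.
        poisson_point_process W \<Xi> (mixture X0 N path_space) \<longrightarrow>
        (\<exists>Y \<in> W \<rightarrow>\<^sub>M path_space.
           (AE w in W. Y w = superposition X0 (\<Xi> w)) \<and>
           super_brownian_law X0 (distr W path_space Y))) \<and>
     (\<forall>\<phi>. test_function \<phi> \<longrightarrow> (\<exists>V. log_laplace_solution \<phi> V \<and>
        (\<forall>t>0. \<forall>x. (\<integral>\<^sup>+\<nu>. ennreal (1 - exp (- (LINT y|\<nu> t. \<phi> y))) \<partial>N x) = ennreal (V t x))))"


subsection \<open>Densities and the right edge\<close>

definition density_field :: "path measure \<Rightarrow> (path \<Rightarrow> real \<Rightarrow> real \<Rightarrow> real) \<Rightarrow> bool" where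
  "density_field M X \<longleftrightarrow>
     (AE \<omega> in M. continuous_on ({0<..} \<times> UNIV) (\<lambda>(t, x). X \<omega> t x) \<and>
        (\<forall>t>0. (\<forall>x. 0 \<le> X \<omega> t x) \<and> \<omega> t = density lborel (\<lambda>x. ennreal (X \<omega> t x))))"

text \<open>Taken in \<^typ>\<open>ereal\<close>, where the infimum of \<open>\<real>\<close> is \<open>-\<infinity>\<close> and \<open>-\<infinity> - u = -\<infinity>\<close>.\<close>

definition right_edge :: "real \<Rightarrow> path \<Rightarrow> real \<Rightarrow> ereal" where
  "right_edge \<epsilon> \<omega> t = Inf (ereal ` {x. measure (\<omega> t) {x..} < \<epsilon>})"

definition edge_mass ::
    "(path \<Rightarrow> real \<Rightarrow> real \<Rightarrow> real) \<Rightarrow> real \<Rightarrow> real \<Rightarrow> real \<Rightarrow> path \<Rightarrow> ennreal" where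
  "edge_mass X \<epsilon> u t \<omega> =
     (\<integral>\<^sup>+x\<in>{x. right_edge \<epsilon> \<omega> t - ereal u \<le> ereal x}. ennreal (X \<omega> t x) \<partial>lborel)"

end

theory Submission
  imports Defs
begin

text \<open>The mass within distance \<open>u\<close> of \<open>\<tau>\<^sup>\<epsilon>(t)\<close> is at most \<open>e\<close> times
  \<open>\<integral> exp (- X\<^sub>t[x + v, \<infinity>) / \<epsilon>) X\<^sub>t(dx)\<close> with \<open>v\<close> of order \<open>u\<close>. Write \<open>D t v l\<close> for the mean of
  \<open>\<integral> exp (- l X\<^sub>t[x + v, \<infinity>)) X\<^sub>t(dx)\<close>. For \<open>v = 0\<close> the integral is at most \<open>(1 - exp (- l X\<^sub>t(1))) / l\<close>,
  so \<open>D t 0 l \<le> 2 m / (l t)\<close>, because the solution with constant initial value \<open>l\<close> is below \<open>2 / t\<close>.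
  For \<open>v > 0\<close>, put \<open>s = max (v\<^sup>2) (1 / l)\<close> and go back from time \<open>t\<close> to time \<open>t - s\<close>: a tagged particle
  moves by \<open>z \<surd>s\<close> with \<open>z\<close> standard normal, and the half-line test function becomes a function
  which is at least a multiple of \<open>1 / s\<close> to the right of any point a bounded number of
  units \<open>\<surd>s\<close> to the left of the half-line. If \<open>z\<close> is below a cut-off this reduces to the case
  \<open>v = 0\<close>; otherwise it gives \<open>D (t - s) (z \<surd>s) (\<kappa> / s)\<close>. Inserting a bound
  \<open>D t v l \<le> b m max (v\<^sup>2) (1 / l) / t\<close> into the second part returns it with \<open>b / 2\<close> once
  the cut-off is large, as the normal law has moments of all orders; iterating removes the
  dependence on the a priori value of \<open>b\<close>.

  For the canonical measure from \<open>x\<close> and for the superprocess the integral of \<open>1 - exp (- X\<^sub>t(\<phi>))\<close> is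
  \<open>G V\<^sup>\<phi>\<^sub>t\<close> with \<open>G f = f x\<close> and \<open>G f = 1 - exp (- X\<^sub>0(f))\<close>, respectively. Nothing else about their
  laws is used, so both bounds are instances of one statement.\<close>


subsection \<open>The heat semigroup\<close>

definition gauss :: "real measure" where
  "gauss = density lborel (\<lambda>x. ennreal (std_normal_density x))"

lemma sets_gauss [measurable_cong, simp]: "sets gauss = sets borel"
  and space_gauss [simp]: "space gauss = UNIV"
  by (simp_all add: gauss_def)

interpretation gauss: prob_space gauss
  unfolding gauss_def by (rule prob_space_normal_density) simp

lemma emeasure_gauss_UNIV [simp]: "emeasure gauss UNIV = 1"
  using gauss.emeasure_space_1 by simp

text \<open>An expectation over a standard normal displacement, with values in
  \<open>ennreal\<close>: Tonelli applies without integrability conditions, and time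
  \<open>0\<close> needs no case distinction.\<close>

definition heat :: "real \<Rightarrow> (real \<Rightarrow> ennreal) \<Rightarrow> real \<Rightarrow> ennreal" where
  "heat t f x = (\<integral>\<^sup>+z. f (x + sqrt t * z) \<partial>gauss)"

lemma heat_measurable_param [measurable (raw)]:
  assumes [measurable]: "(\<lambda>(w, y). F w y) \<in> borel_measurable (N \<Otimes>\<^sub>M borel)"
    "t \<in> borel_measurable N" "x \<in> borel_measurable N"
  shows "(\<lambda>w. heat (t w) (F w) (x w)) \<in> borel_measurable N"
  unfolding heat_def by measurable

lemma heat_mono: "(\<And>y. f y \<le> g y) \<Longrightarrow> heat t f x \<le> heat t g x"
  unfolding heat_def by (intro nn_integral_mono) auto

lemma heat_const [simp]: "heat t (\<lambda>_. c) x = c"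
  by (simp add: heat_def)

lemma heat_zero [simp]: "heat 0 f x = f x"
  by (simp add: heat_def)

lemma heat_add:
  assumes [measurable]: "f \<in> borel_measurable borel" "g \<in> borel_measurable borel"
  shows "heat t (\<lambda>y. f y + g y) x = heat t f x + heat t g x"
  unfolding heat_def by (subst nn_integral_add) auto

lemma heat_cmult:
  assumes [measurable]: "f \<in> borel_measurable borel"
  shows "heat t (\<lambda>y. c * f y) x = c * heat t f x"
  unfolding heat_def by (subst nn_integral_cmult) auto

lemma heat_conv_density:
  assumes [measurable]: "f \<in> borel_measurable borel" and t: "0 < t"
  shows "heat t f x = (\<integral>\<^sup>+y. ennreal (normal_density 0 (sqrt t) y) * f (x + y) \<partial>lborel)"
proof -
  have "(\<integral>\<^sup>+y. ennreal (normal_density 0 (sqrt t) y) * f (x + y) \<partial>lborel) =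
    ennreal \<bar>sqrt t\<bar> * (\<integral>\<^sup>+z. ennreal (normal_density 0 (sqrt t) (0 + sqrt t * z)) * f (x + (0 + sqrt t * z)) \<partial>lborel)"
    using t by (intro nn_integral_real_affine) auto
  also have "\<dots> = (\<integral>\<^sup>+z. ennreal (sqrt t) * (ennreal (normal_density 0 (sqrt t) (sqrt t * z)) * f (x + sqrt t * z)) \<partial>lborel)"
    using t by (subst nn_integral_cmult[symmetric]) (auto)
  also have "\<dots> = (\<integral>\<^sup>+z. ennreal (std_normal_density z) * f (x + sqrt t * z) \<partial>lborel)"
  proof (intro nn_integral_cong)
    fix z
    have "sqrt t * normal_density 0 (sqrt t) (sqrt t * z) = std_normal_density z"
      using t by (simp add: normal_density_def real_sqrt_mult power_mult_distrib field_simps)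
    then show "ennreal (sqrt t) * (ennreal (normal_density 0 (sqrt t) (sqrt t * z)) * f (x + sqrt t * z))
      = ennreal (std_normal_density z) * f (x + sqrt t * z)"
      using t by (simp add: mult.assoc[symmetric] ennreal_mult[symmetric])
  qed
  also have "\<dots> = heat t f x"
    unfolding heat_def gauss_def by (subst nn_integral_density) auto
  finally show ?thesis by simp
qed

text \<open>Centred normal densities convolve with variances adding. A vanishing time is treated
  apart, since it has no density.\<close>

lemma heat_heat:
  assumes [measurable]: "f \<in> borel_measurable borel" and s: "0 \<le> s" and t: "0 \<le> t"
  shows "heat s (heat t f) x = heat (s + t) f x"
proof (cases "s = 0 \<or> t = 0")
  case True
  then show ?thesis by (auto simp: heat_def)
next
  case False
  then have s: "0 < s" and t: "0 < t" using s t by auto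
  let ?p = "\<lambda>t y. ennreal (normal_density 0 (sqrt t) y)"
  have [measurable]: "heat t f \<in> borel_measurable borel" by measurable
  have shift: "heat t f (x + y) = (\<integral>\<^sup>+z. ?p t (z - y) * f (x + z) \<partial>lborel)" for y
    using nn_integral_real_affine[of "\<lambda>z. ?p t (z - y) * f (x + z)" 1 y]
    by (subst heat_conv_density) (auto simp: t add_ac)
  have "heat s (heat t f) x = (\<integral>\<^sup>+y. \<integral>\<^sup>+z. ?p s y * (?p t (z - y) * f (x + z)) \<partial>lborel \<partial>lborel)"
    by (subst heat_conv_density) (auto simp: s shift nn_integral_cmult)
  also have "\<dots> = (\<integral>\<^sup>+z. \<integral>\<^sup>+y. ?p s y * (?p t (z - y) * f (x + z)) \<partial>lborel \<partial>lborel)"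
    by (rule lborel_pair.Fubini') measurable
  also have "\<dots> = (\<integral>\<^sup>+z. (\<integral>\<^sup>+y. ennreal (normal_density 0 (sqrt t) (z - y) * normal_density 0 (sqrt s) y) \<partial>lborel) * f (x + z) \<partial>lborel)"
    by (intro nn_integral_cong, subst nn_integral_multc[symmetric])
       (auto simp: ennreal_mult mult_ac intro!: nn_integral_cong)
  also have "\<dots> = (\<integral>\<^sup>+z. ?p (s + t) z * f (x + z) \<partial>lborel)"
    using conv_normal_density_zero_mean[of "sqrt t" "sqrt s"] s t
    by (intro nn_integral_cong) (auto simp: fun_eq_iff add_ac)
  also have "\<dots> = heat (s + t) f x"
    using s t by (subst heat_conv_density) auto
  finally show ?thesis .
qed

text \<open>The bound on \<open>f\<close> makes the Bochner integral a genuine one, so that it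
  agrees with the integral in \<open>ennreal\<close>.\<close>

lemma heat_semigroup_eq:
  assumes [measurable]: "f \<in> borel_measurable borel" and t: "0 \<le> t"
    and nn: "\<And>y. 0 \<le> f y" and B: "\<And>y. f y \<le> B"
  shows "ennreal (heat_semigroup t f x) = heat t (\<lambda>y. ennreal (f y)) x"
proof (cases "t = 0")
  case True
  then show ?thesis by (simp add: heat_semigroup_def)
next
  case False
  with t have t: "0 < t" by simp
  have "integrable lborel (\<lambda>y. normal_density x (sqrt t) y * f y)"
    using t nn B
    by (intro Bochner_Integration.integrable_bound[OF integrable_mult_right[OF integrable_normal_density[of "sqrt t" x], of B]])
       (auto intro!: AE_I2 simp: abs_mult mult.commute[of B] intro!: mult_left_mono order_trans[OF B])
  then have "ennreal (heat_semigroup t f x) = (\<integral>\<^sup>+y. ennreal (normal_density x (sqrt t) y * f y) \<partial>lborel)"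
    using t nn by (simp add: heat_semigroup_def nn_integral_eq_integral)
  also have "\<dots> = (\<integral>\<^sup>+y. ennreal (normal_density 0 (sqrt t) y) * ennreal (f (x + y)) \<partial>lborel)"
    using nn_integral_real_affine[of "\<lambda>y. ennreal (normal_density x (sqrt t) y * f y)" 1 x] nn
    by (simp add: ennreal_mult[symmetric] normal_density_def)
  finally show ?thesis using t by (subst heat_conv_density) auto
qed


subsection \<open>Mild solutions of the log-Laplace equation\<close>

text \<open>The quadratic term stands on the left, which avoids subtraction in
  \<open>ennreal\<close>. Measurability and nonnegativity are asked at all real times, so that joint
  measurability is that of the full product; the equation is asked at nonnegative times
  only.\<close>

definition mild :: "(real \<Rightarrow> real) \<Rightarrow> (real \<Rightarrow> real \<Rightarrow> real) \<Rightarrow> bool" where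
  "mild \<phi> V \<longleftrightarrow> (\<lambda>(t, x). V t x) \<in> borel_measurable (borel \<Otimes>\<^sub>M borel) \<and> (\<forall>t x. 0 \<le> V t x) \<and>
     (\<forall>t\<ge>0. \<forall>x. ennreal (V t x) + (\<integral>\<^sup>+q\<in>{0..t}. heat (t - q) (\<lambda>y. ennreal ((V q y)\<^sup>2 / 2)) x \<partial>lborel)
        = heat t (\<lambda>y. ennreal (\<phi> y)) x)"

lemma mild_measurable: "mild \<phi> V \<Longrightarrow> (\<lambda>(t, x). V t x) \<in> borel_measurable (borel \<Otimes>\<^sub>M borel)"
  and mild_nonneg: "mild \<phi> V \<Longrightarrow> 0 \<le> V t x"
  and mild_eq: "mild \<phi> V \<Longrightarrow> 0 \<le> t \<Longrightarrow>
     ennreal (V t x) + (\<integral>\<^sup>+q\<in>{0..t}. heat (t - q) (\<lambda>y. ennreal ((V q y)\<^sup>2 / 2)) x \<partial>lborel)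
        = heat t (\<lambda>y. ennreal (\<phi> y)) x"
  by (auto simp: mild_def)

lemma mild_measurable' [measurable_dest]: "mild \<phi> V \<Longrightarrow> V t \<in> borel_measurable borel"
  using measurable_compose_Pair1[of t borel "\<lambda>(t, x). V t x" borel borel] by (auto dest: mild_measurable)

lemma mild_le_heat: "mild \<phi> V \<Longrightarrow> 0 \<le> t \<Longrightarrow> ennreal (V t x) \<le> heat t (\<lambda>y. ennreal (\<phi> y)) x"
  by (simp flip: mild_eq)

lemma mild_le:
  assumes "mild \<phi> V" "0 \<le> t" "\<And>x. \<phi> x \<le> B" "0 \<le> B"
  shows "V t x \<le> B"
proof -
  have "ennreal (V t x) \<le> heat t (\<lambda>y. ennreal (\<phi> y)) x"
    by (rule mild_le_heat) fact+
  also have "\<dots> \<le> heat t (\<lambda>y. ennreal B) x"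
    using assms by (intro heat_mono ennreal_leI)
  finally show ?thesis using assms by simp
qed

text \<open>The integral is dominated by the linear term, which is at most \<open>B\<close>.
  Finiteness is what allows it to be cancelled from both sides in \<open>ennreal\<close>.\<close>

lemma mild_integral_finite:
  assumes "mild \<phi> V" "0 \<le> t" "\<And>x. \<phi> x \<le> B" "0 \<le> B"
  shows "(\<integral>\<^sup>+q\<in>{0..t}. heat (t - q) (\<lambda>y. ennreal ((V q y)\<^sup>2 / 2)) x \<partial>lborel) < \<infinity>"
proof -
  have "(\<integral>\<^sup>+q\<in>{0..t}. heat (t - q) (\<lambda>y. ennreal ((V q y)\<^sup>2 / 2)) x \<partial>lborel) \<le> heat t (\<lambda>y. ennreal (\<phi> y)) x"
    by (simp flip: mild_eq[OF assms(1,2)])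
  also have "\<dots> \<le> heat t (\<lambda>y. ennreal B) x"
    using assms by (intro heat_mono ennreal_leI)
  finally show ?thesis by (simp add: order_le_less_trans)
qed

section \<open>Passage from the real-valued equation to its \<open>ennreal\<close> form\<close>

lemma log_laplace_solution_le:
  assumes V: "log_laplace_solution \<phi> V" and \<phi>: "\<phi> \<in> borel_measurable borel" "\<And>x. 0 \<le> \<phi> x" "\<And>x. \<phi> x \<le> B" "0 \<le> t"
  shows "V t x \<le> B"
proof -
  have nn: "0 \<le> heat_semigroup t (\<lambda>y. (V s y)\<^sup>2 / 2) x" for s t x
    unfolding heat_semigroup_def by (auto intro!: integral_nonneg_AE)
  have "0 \<le> B" using \<phi>(2)[of 0] \<phi>(3)[of 0] by simp
  have "V t x \<le> heat_semigroup t \<phi> x"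
    using V nn \<open>0 \<le> t\<close> unfolding log_laplace_solution_def set_lebesgue_integral_def by (auto intro!: integral_nonneg_AE)
  also have "\<dots> \<le> B"
  proof -
    have "ennreal (heat_semigroup t \<phi> x) = heat t (\<lambda>y. ennreal (\<phi> y)) x"
      by (rule heat_semigroup_eq) (use \<phi> in auto)
    also have "\<dots> \<le> heat t (\<lambda>y. ennreal B) x"
      using \<phi> by (intro heat_mono ennreal_leI)
    finally show ?thesis using \<open>0 \<le> B\<close> by simp
  qed
  finally show ?thesis .
qed

text \<open>Extension by \<open>0\<close> to negative times makes a solution jointly measurable on
  the plane. Boundedness of the solution rules out default values of the Bochner integrals.\<close>

lemma mild_of_log_laplace_solution:
  assumes V: "log_laplace_solution \<phi> V" and \<phi>: "test_function \<phi>"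
  shows "mild \<phi> (\<lambda>t x. if 0 \<le> t then V t x else 0)" (is "mild \<phi> ?V")
proof -
  obtain B where B: "\<And>x. \<phi> x \<le> B"
    using \<phi> by (auto simp: test_function_def bounded_iff intro: order_trans[OF abs_ge_self])
  have \<phi>': "\<phi> \<in> borel_measurable borel" "\<And>x. 0 \<le> \<phi> x" using \<phi> by (auto simp: test_function_def)
  have B0: "0 \<le> B" using \<phi>'(2)[of 0] B[of 0] by simp
  have "(\<lambda>(t, x). V t x) \<in> borel_measurable (restrict_space borel ({0..} \<times> UNIV))"
    using V by (simp add: log_laplace_solution_def)
  moreover have "{0..} \<times> UNIV \<in> sets (borel :: (real \<times> real) measure)"
    by (intro borel_closed closed_Times) auto
  ultimately have m: "(\<lambda>p. if p \<in> {0..} \<times> UNIV then (\<lambda>(t, x). V t x) p else 0) \<in> borel_measurable borel"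
    by (intro measurable_If_restrict_space_iff[THEN iffD2]) auto
  have m [measurable]: "(\<lambda>(t, x). ?V t x) \<in> borel_measurable (borel \<Otimes>\<^sub>M borel)"
    using m by (simp add: borel_prod case_prod_beta mem_Times_iff cong: if_cong)
  have nn: "0 \<le> ?V t x" for t x proof -
    have "0 \<le> V t x" if "0 \<le> t" using V that unfolding log_laplace_solution_def by blast
    then show ?thesis by simp
  qed
  have [measurable]: "?V t \<in> borel_measurable borel" for t
    using measurable_compose_Pair1[of t borel "\<lambda>(t, x). ?V t x" borel borel] m by simp
  have le: "?V t x \<le> B" for t x using log_laplace_solution_le[OF V \<phi>' B] B0 by simp
  have le2: "(?V t x)\<^sup>2 / 2 \<le> B\<^sup>2 / 2" for t x using le[of t x] nn[of t x] by (intro divide_right_mono power_mono) auto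
  have "ennreal (?V t x) + (\<integral>\<^sup>+q\<in>{0..t}. heat (t - q) (\<lambda>y. ennreal ((?V q y)\<^sup>2 / 2)) x \<partial>lborel)
        = heat t (\<lambda>y. ennreal (\<phi> y)) x" if t: "0 \<le> t" for t x
  proof -
    let ?I = "\<integral>\<^sup>+q\<in>{0..t}. heat (t - q) (\<lambda>y. ennreal ((?V q y)\<^sup>2 / 2)) x \<partial>lborel"
    have h: "ennreal (heat_semigroup (t - q) (\<lambda>y. (V q y)\<^sup>2 / 2) x) = heat (t - q) (\<lambda>y. ennreal ((V q y)\<^sup>2 / 2)) x"
      if "0 \<le> q" "q \<le> t" for q
    proof (rule heat_semigroup_eq)
      show "(\<lambda>y. (V q y)\<^sup>2 / 2) \<in> borel_measurable borel"
        using \<open>\<And>t. ?V t \<in> borel_measurable borel\<close>[of q] that by (simp cong: if_cong)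
      show "(V q y)\<^sup>2 / 2 \<le> B\<^sup>2 / 2" for y using le2[of q y] that by simp
    qed (use that in auto)
    have hnn: "0 \<le> heat_semigroup (t - q) (\<lambda>y. (V q y)\<^sup>2 / 2) x" for q
      unfolding heat_semigroup_def by (auto intro!: integral_nonneg_AE)
    have "?I \<le> (\<integral>\<^sup>+q\<in>{0..t}. ennreal (B\<^sup>2/2) \<partial>lborel)"
    proof (intro nn_integral_mono mult_right_mono)
      fix q
      have "heat (t - q) (\<lambda>y. ennreal ((?V q y)\<^sup>2 / 2)) x \<le> heat (t - q) (\<lambda>y. ennreal (B\<^sup>2 / 2)) x"
        by (intro heat_mono ennreal_leI le2)
      then show "heat (t - q) (\<lambda>y. ennreal ((?V q y)\<^sup>2 / 2)) x \<le> ennreal (B\<^sup>2/2)" by simp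
    qed simp
    also have "\<dots> < \<infinity>" using t by (simp add: nn_integral_cmult_indicator ennreal_mult_less_top)
    finally have fin: "?I < \<infinity>" .
    have eqI: "?I = (\<integral>\<^sup>+q. ennreal (indicator {0..t} q *\<^sub>R heat_semigroup (t - q) (\<lambda>y. (V q y)\<^sup>2 / 2) x) \<partial>lborel)"
      by (intro nn_integral_cong) (auto simp: h[symmetric] indicator_def)
    \<comment> \<open>Measurability in \<open>q\<close> is read off from \<open>heat\<close>, which
      is measurable jointly in its parameters, and carried over to
      \<open>heat_semigroup\<close>.\<close>
    have "(\<lambda>q. enn2real (heat (t - q) (\<lambda>y. ennreal ((?V q y)\<^sup>2 / 2)) x) * indicator {0..t} q) \<in> borel_measurable lborel"
      by measurable
    also have "(\<lambda>q. enn2real (heat (t - q) (\<lambda>y. ennreal ((?V q y)\<^sup>2 / 2)) x) * indicator {0..t} q)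
       = (\<lambda>q. indicator {0..t} q *\<^sub>R heat_semigroup (t - q) (\<lambda>y. (V q y)\<^sup>2 / 2) x)"
      by (auto simp: h[symmetric] indicator_def fun_eq_iff hnn)
    finally have meas: "(\<lambda>q. indicator {0..t} q *\<^sub>R heat_semigroup (t - q) (\<lambda>y. (V q y)\<^sup>2 / 2) x) \<in> borel_measurable lborel" .
    have int: "integrable lborel (\<lambda>q. indicator {0..t} q *\<^sub>R heat_semigroup (t - q) (\<lambda>y. (V q y)\<^sup>2 / 2) x)"
      using fin hnn meas by (intro integrableI_nonneg) (auto simp: eqI)
    have I: "?I = ennreal (LINT q:{0..t}|lborel. heat_semigroup (t - q) (\<lambda>y. (V q y)\<^sup>2 / 2) x)"
      unfolding eqI set_lebesgue_integral_def using int hnn by (intro nn_integral_eq_integral) auto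
    let ?L = "LINT q:{0..t}|lborel. heat_semigroup (t - q) (\<lambda>y. (V q y)\<^sup>2 / 2) x"
    have Vt: "V t x = heat_semigroup t \<phi> x - ?L" and V0: "0 \<le> V t x"
      using V t unfolding log_laplace_solution_def by blast+
    have "0 \<le> ?L"
      using hnn by (auto simp: set_lebesgue_integral_def intro!: integral_nonneg_AE)
    with V0 have "ennreal (?V t x) + ?I = ennreal (V t x + ?L)"
      unfolding I using t by simp
    also have "V t x + ?L = heat_semigroup t \<phi> x"
      using Vt by simp
    also have "ennreal (heat_semigroup t \<phi> x) = heat t (\<lambda>y. ennreal (\<phi> y)) x"
      by (rule heat_semigroup_eq) (use \<phi>' B t in auto)
    finally show ?thesis .
  qed
  then show ?thesis using m nn unfolding mild_def by blast
qed

section \<open>Uniqueness and the flow property\<close>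

text \<open>Picard iteration: both solutions lie in \<open>[0, B]\<close>, so half the difference of
  their squares is at most \<open>B\<close> times their difference, and each integration in time
  gains a factor \<open>B * t / (n + 1)\<close>.\<close>

lemma mild_unique_aux:
  assumes V: "mild \<phi> V" and W: "mild \<phi> W" and B: "\<And>x. \<phi> x \<le> B" "0 \<le> B" and t: "0 \<le> t"
  shows "\<bar>V t x - W t x\<bar> \<le> B * (B * t) ^ n / fact n"
  using t
proof (induction n arbitrary: t x)
  case 0
  have "0 \<le> V t x" "V t x \<le> B" "0 \<le> W t x" "W t x \<le> B"
    using 0 mild_nonneg[OF V] mild_nonneg[OF W] mild_le[OF V 0 B] mild_le[OF W 0 B] by auto
  then show ?case by (simp add: abs_le_iff)
next
  case (Suc n)
  \<comment> \<open>One-sided and for an arbitrary pair of solutions, so that it can be applied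
    twice with the roles exchanged.\<close>
  have *: "V t x \<le> W t x + B * (B * t) ^ Suc n / fact (Suc n)"
    if V: "mild \<phi> V" and W: "mild \<phi> W"
    and IH: "\<And>t x. 0 \<le> t \<Longrightarrow> \<bar>V t x - W t x\<bar> \<le> B * (B * t) ^ n / fact n" for V W
  proof -
    note [measurable] = mild_measurable[OF V] mild_measurable[OF W]
    let ?J = "\<lambda>V. \<integral>\<^sup>+q\<in>{0..t}. heat (t - q) (\<lambda>y. ennreal ((V q y)\<^sup>2 / 2)) x \<partial>lborel"
    \<comment> \<open>The induction bound with one more factor \<open>B\<close> from the difference
      of squares, and with the power of \<open>q\<close> taken out.\<close>
    define c where "c = B ^ (n + 2) / fact n"
    have c: "0 \<le> c" using B by (simp add: c_def)
    have pt: "heat (t - q) (\<lambda>y. ennreal ((W q y)\<^sup>2 / 2)) x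
        \<le> heat (t - q) (\<lambda>y. ennreal ((V q y)\<^sup>2 / 2)) x + ennreal (c * q ^ n)" if q: "0 \<le> q" for q
    proof -
      have "(W q y)\<^sup>2 / 2 \<le> (V q y)\<^sup>2 / 2 + c * q ^ n" for y
      proof -
        have b: "0 \<le> V q y" "V q y \<le> B" "0 \<le> W q y" "W q y \<le> B"
          using mild_nonneg[OF V] mild_nonneg[OF W] mild_le[OF V q B] mild_le[OF W q B] by auto
        have "(W q y)\<^sup>2 / 2 - (V q y)\<^sup>2 / 2 = (W q y - V q y) * ((W q y + V q y) / 2)"
          by (simp add: power2_eq_square field_simps)
        also have "\<dots> \<le> \<bar>V q y - W q y\<bar> * B"
          using b by (intro mult_mono) auto
        also have "\<dots> \<le> (B * (B * q) ^ n / fact n) * B"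
          using B by (intro mult_right_mono IH q)
        also have "\<dots> = c * q ^ n"
          by (simp add: power_mult_distrib mult_ac c_def)
        finally show ?thesis by linarith
      qed
      then have "heat (t - q) (\<lambda>y. ennreal ((W q y)\<^sup>2 / 2)) x
        \<le> heat (t - q) (\<lambda>y. ennreal ((V q y)\<^sup>2 / 2) + ennreal (c * q ^ n)) x"
        using c q by (intro heat_mono) (auto simp: ennreal_plus[symmetric] simp del: ennreal_plus intro!: ennreal_leI)
      also have "\<dots> = heat (t - q) (\<lambda>y. ennreal ((V q y)\<^sup>2 / 2)) x + ennreal (c * q ^ n)"
        using mild_measurable'[OF V] by (subst heat_add) auto
      finally show ?thesis .
    qed
    have "?J W \<le> (\<integral>\<^sup>+q\<in>{0..t}. heat (t - q) (\<lambda>y. ennreal ((V q y)\<^sup>2 / 2)) x + ennreal (c * q ^ n) \<partial>lborel)"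
      by (intro nn_integral_mono) (auto simp: indicator_def intro: pt)
    also have "\<dots> = ?J V + (\<integral>\<^sup>+q. ennreal (c * q ^ n) * indicator {0..t} q \<partial>lborel)"
      by (subst nn_integral_add[symmetric]) (auto simp: distrib_right)
    also have "(\<integral>\<^sup>+q. ennreal (c * q ^ n) * indicator {0..t} q \<partial>lborel) = ennreal (c * t ^ Suc n / Suc n - c * 0 ^ Suc n / Suc n)"
      using c Suc.prems
      by (intro nn_integral_FTC_Icc) (auto intro!: derivative_eq_intros simp del: of_nat_Suc power_Suc)
    also have "c * t ^ Suc n / Suc n - c * 0 ^ Suc n / Suc n = B * (B * t) ^ Suc n / fact (Suc n)"
      by (simp add: power_mult_distrib field_simps c_def)
    finally have J: "?J W \<le> ?J V + ennreal (B * (B * t) ^ Suc n / fact (Suc n))" .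
    define e where "e = B * (B * t) ^ Suc n / fact (Suc n)"
    have e: "0 \<le> e" using B Suc.prems by (simp add: e_def)
    \<comment> \<open>The two equations share the linear term, so \<open>V\<close> exceeds
      \<open>W\<close> by at most the excess of the quadratic integral of \<open>W\<close> over that
      of \<open>V\<close>.\<close>
    have "?J V + ennreal (V t x) = ennreal (W t x) + ?J W"
      using mild_eq[OF V Suc.prems, of x] mild_eq[OF W Suc.prems, of x] by (simp add: add.commute)
    also have "\<dots> \<le> ennreal (W t x) + (?J V + ennreal e)"
      using J by (intro add_left_mono) (simp only: e_def)
    also have "\<dots> = ?J V + ennreal (W t x + e)"
      using e mild_nonneg[OF W, of t x] by (simp add: ac_simps)
    finally have "ennreal (V t x) \<le> ennreal (W t x + e)"
      using mild_integral_finite[OF V Suc.prems B, of x] by (subst (asm) ennreal_add_left_cancel_le) auto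
    then show ?thesis
      using e mild_nonneg[OF W, of t x] unfolding e_def[symmetric] by (subst (asm) ennreal_le_iff) auto
  qed
  from *[OF V W Suc.IH] *[OF W V] Suc.IH show ?case by (fastforce simp: abs_le_iff abs_minus_commute)
qed

lemma mild_unique:
  assumes "mild \<phi> V" "mild \<phi> W" "\<And>x. \<phi> x \<le> B" "0 \<le> B" "0 \<le> t"
  shows "V t x = W t x"
proof -
  have "(\<lambda>n. B * (B * t) ^ n / fact n) \<longlonglongrightarrow> B * 0"
    using tendsto_mult[OF tendsto_const, OF summable_LIMSEQ_zero[OF summable_exp[of "B * t"]], of B] 
    by (simp add: field_simps)
  then have "\<bar>V t x - W t x\<bar> \<le> B * 0"
    by (rule LIMSEQ_le_const) (use mild_unique_aux[OF assms] in auto)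
  then show ?thesis by simp
qed

text \<open>The heat semigroup over time \<open>t\<close> is applied to the equation at time
  \<open>s\<close>, and the result is compared with the equation at time \<open>s + t\<close>. The
  part of the time integral over \<open>[0, s]\<close> occurs on both sides, is finite, and
  cancels.\<close>

lemma mild_shift:
  assumes V: "mild \<phi> V" and \<phi>[measurable]: "\<phi> \<in> borel_measurable borel" and B: "\<And>x. \<phi> x \<le> B" "0 \<le> B" and s: "0 \<le> s"
  shows "mild (V s) (\<lambda>t. V (s + t))"
proof -
  note [measurable] = mild_measurable[OF V] mild_measurable'[OF V]
  have "ennreal (V (s + t) x) + (\<integral>\<^sup>+q\<in>{0..t}. heat (t - q) (\<lambda>y. ennreal ((V (s + q) y)\<^sup>2 / 2)) x \<partial>lborel)
        = heat t (\<lambda>y. ennreal (V s y)) x" if t: "0 \<le> t" for t x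
  proof -
    let ?g = "\<lambda>q y. ennreal ((V q y)\<^sup>2 / 2)"
    let ?A = "\<integral>\<^sup>+q\<in>{0..s}. heat (s + t - q) (?g q) x \<partial>lborel"
    let ?C = "\<integral>\<^sup>+q\<in>{0..t}. heat (t - q) (?g (s + q)) x \<partial>lborel"
    have "(\<integral>\<^sup>+q\<in>{0..s+t}. heat (s + t - q) (?g q) x \<partial>lborel) =
       (\<integral>\<^sup>+q. heat (s + t - q) (?g q) x * indicator {0..s} q + heat (s + t - q) (?g q) x * indicator {s..s+t} q \<partial>lborel)"
      \<comment> \<open>The two closed intervals overlap in the single point \<open>s\<close>, a
        null set.\<close>
      using AE_lborel_singleton[of s] s t
      by (intro nn_integral_cong_AE) (auto elim!: eventually_mono simp: indicator_def)
    also have "\<dots> = ?A + (\<integral>\<^sup>+q. heat (s + t - q) (?g q) x * indicator {s..s+t} q \<partial>lborel)"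
      by (intro nn_integral_add) measurable
    also have "(\<integral>\<^sup>+q. heat (s + t - q) (?g q) x * indicator {s..s+t} q \<partial>lborel) = ?C"
      by (subst nn_integral_real_affine[where c = 1 and t = s]) (auto intro!: nn_integral_cong simp: indicator_def)
    finally have split: "(\<integral>\<^sup>+q\<in>{0..s+t}. heat (s + t - q) (?g q) x \<partial>lborel) = ?A + ?C" .
    have "heat t (\<lambda>y. \<integral>\<^sup>+q\<in>{0..s}. heat (s - q) (?g q) y \<partial>lborel) x
      = (\<integral>\<^sup>+q. \<integral>\<^sup>+z. heat (s - q) (?g q) (x + sqrt t * z) * indicator {0..s} q \<partial>gauss \<partial>lborel)"
      unfolding heat_def[of t] by (rule pair_sigma_finite.Fubini'[OF pair_sigma_finite.intro])
        (auto intro: lborel.sigma_finite_measure_axioms gauss.sigma_finite_measure_axioms)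
    also have "\<dots> = ?A"
    proof (intro nn_integral_cong)
      fix q
      have "q \<in> {0..s} \<Longrightarrow> heat t (heat (s - q) (?g q)) x = heat (s + t - q) (?g q) x"
        using t by (subst heat_heat) (auto simp: algebra_simps)
      then show "(\<integral>\<^sup>+z. heat (s - q) (?g q) (x + sqrt t * z) * indicator {0..s} q \<partial>gauss) = heat (s + t - q) (?g q) x * indicator {0..s} q"
        by (auto simp: indicator_def heat_def[of t])
    qed
    finally have A: "heat t (\<lambda>y. \<integral>\<^sup>+q\<in>{0..s}. heat (s - q) (?g q) y \<partial>lborel) x = ?A" .
    have "?A + (ennreal (V (s + t) x) + ?C) = heat (s + t) (\<lambda>y. ennreal (\<phi> y)) x"
      using s t mild_eq[OF V, of "s + t" x] by (simp only: split) (simp add: ac_simps)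
    also have "\<dots> = heat t (heat s (\<lambda>y. ennreal (\<phi> y))) x"
      using s t by (subst heat_heat) (auto simp: add_ac)
    also have "heat s (\<lambda>y. ennreal (\<phi> y)) = (\<lambda>y. ennreal (V s y) + (\<integral>\<^sup>+q\<in>{0..s}. heat (s - q) (?g q) y \<partial>lborel))"
      using mild_eq[OF V s] by auto
    also have "heat t \<dots> x = ?A + heat t (\<lambda>y. ennreal (V s y)) x"
      by (subst heat_add) (auto simp: A add.commute)
    finally have eq: "?A + (ennreal (V (s + t) x) + ?C) = ?A + heat t (\<lambda>y. ennreal (V s y)) x" .
    have "0 \<le> s + t" using s t by simp
    from mild_integral_finite[OF V this B, of x] have "?A < \<infinity>"
      by (auto simp: split less_top)
    with eq show ?thesis by (subst (asm) ennreal_add_left_cancel) auto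
  qed
  then show ?thesis
    unfolding mild_def using mild_nonneg[OF V] by (auto simp: s)
qed

section \<open>A lower and an upper bound for solutions\<close>

text \<open>The solution stays below \<open>1 / s\<close>, so the quadratic loss rate is at most
  \<open>1 / (2 * s)\<close> times the linear flow. Over a time span \<open>s\<close> the loss is at
  most half of the linear solution.\<close>

lemma mild_half_heat_le:
  assumes V: "mild \<phi> V" and [measurable]: "\<phi> \<in> borel_measurable borel" and s: "0 < s" and \<phi>: "\<And>x. \<phi> x \<le> 1 / s"
  shows "heat s (\<lambda>y. ennreal (\<phi> y)) x \<le> 2 * ennreal (V s x)"
proof -
  note [measurable] = mild_measurable[OF V] mild_measurable'[OF V]
  let ?H = "heat s (\<lambda>y. ennreal (\<phi> y)) x"
  have "heat (s - q) (\<lambda>y. ennreal ((V q y)\<^sup>2 / 2)) x \<le> ennreal (1 / (2 * s)) * ?H" if q: "0 \<le> q" "q \<le> s" for q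
  proof -
    have "ennreal ((V q y)\<^sup>2 / 2) \<le> ennreal (1 / (2 * s)) * heat q (\<lambda>y. ennreal (\<phi> y)) y" for y
    proof -
      have "V q y * V q y \<le> 1 / s * V q y"
        using mild_le[OF V q(1) \<phi>, of y] mild_nonneg[OF V, of q y] s by (intro mult_right_mono) auto
      then have "(V q y)\<^sup>2 / 2 \<le> 1 / (2 * s) * V q y"
        by (simp add: power2_eq_square)
      then have "ennreal ((V q y)\<^sup>2 / 2) \<le> ennreal (1 / (2 * s)) * ennreal (V q y)"
        using mild_nonneg[OF V, of q y] s by (simp add: ennreal_mult[symmetric] ennreal_leI)
      also have "\<dots> \<le> ennreal (1 / (2 * s)) * heat q (\<lambda>y. ennreal (\<phi> y)) y"
        by (intro mult_left_mono mild_le_heat[OF V q(1)]) simp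
      finally show ?thesis .
    qed
    then have "heat (s - q) (\<lambda>y. ennreal ((V q y)\<^sup>2 / 2)) x \<le> heat (s - q) (\<lambda>y. ennreal (1 / (2 * s)) * heat q (\<lambda>y. ennreal (\<phi> y)) y) x"
      by (rule heat_mono)
    also have "\<dots> = ennreal (1 / (2 * s)) * ?H"
      using q by (subst heat_cmult) (auto simp: heat_heat)
    finally show ?thesis .
  qed
  then have "(\<integral>\<^sup>+q\<in>{0..s}. heat (s - q) (\<lambda>y. ennreal ((V q y)\<^sup>2 / 2)) x \<partial>lborel) \<le>
     (\<integral>\<^sup>+q\<in>{0..s}. ennreal (1 / (2 * s)) * ?H \<partial>lborel)"
    by (intro nn_integral_mono) (auto simp: indicator_def)
  also have "\<dots> = ennreal (1/2) * ?H"
  proof -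
    have "ennreal (1 / (2 * s)) * ?H * ennreal s = ennreal (1/2) * ?H"
    proof -
      have "ennreal (1 / (2 * s)) * ?H * ennreal s = ennreal (1 / (2 * s)) * ennreal s * ?H"
        by (simp only: ac_simps)
      also have "ennreal (1 / (2 * s)) * ennreal s = ennreal (1/2)"
        using s by (subst ennreal_mult[symmetric]) auto
      finally show ?thesis .
    qed
    then show ?thesis using s by (subst nn_integral_cmult_indicator) auto
  qed
  finally have J: "(\<integral>\<^sup>+q\<in>{0..s}. heat (s - q) (\<lambda>y. ennreal ((V q y)\<^sup>2 / 2)) x \<partial>lborel) \<le> ennreal (1/2) * ?H" .
  have "?H = ennreal (V s x) + (\<integral>\<^sup>+q\<in>{0..s}. heat (s - q) (\<lambda>y. ennreal ((V q y)\<^sup>2 / 2)) x \<partial>lborel)"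
    using s by (intro mild_eq[OF V, symmetric]) simp
  also have "\<dots> \<le> ennreal (V s x) + ennreal (1/2) * ?H"
    by (rule add_left_mono[OF J])
  finally have "?H \<le> ennreal (V s x) + ennreal (1/2) * ?H" .
  then have "2 * ?H \<le> 2 * (ennreal (V s x) + ennreal (1/2) * ?H)"
    by (rule mult_left_mono) simp
  also have "\<dots> = 2 * ennreal (V s x) + (ennreal 2 * ennreal (1/2)) * ?H"
    by (simp only: distrib_left mult.assoc ennreal_numeral)
  also have "ennreal 2 * ennreal (1/2) = 1"
    by (subst ennreal_mult[symmetric]) auto
  finally have le: "2 * ?H \<le> 2 * ennreal (V s x) + ?H" by simp
  \<comment> \<open>One copy of \<open>?H\<close> is cancelled below, which needs \<open>?H\<close>
    to be finite.\<close>
  have "?H \<le> heat s (\<lambda>y. ennreal (1 / s)) x"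
    using \<phi> by (intro heat_mono ennreal_leI)
  then have "?H < \<infinity>" by (simp add: order_le_less_trans)
  moreover have "?H + ?H \<le> ?H + 2 * ennreal (V s x)" using le by (simp add: mult_2 add.commute)
  ultimately show ?thesis by (subst (asm) ennreal_add_left_cancel_le) auto
qed

text \<open>This is the solution of \<open>y' = - y\<^sup>2 / 2\<close> with \<open>y 0 = c\<close>;
  \<open>max 0 t\<close> keeps the formula nonnegative at negative times.\<close>

lemma mild_const:
  assumes c: "0 \<le> c"
  shows "mild (\<lambda>_. c) (\<lambda>t _. c / (1 + c * max 0 t / 2))"
proof -
  have pos: "0 < 1 + c * q / 2" if "0 \<le> q" for q using c that by (simp add: add_pos_nonneg)
  have "ennreal (c / (1 + c * t / 2)) + (\<integral>\<^sup>+q\<in>{0..t}. ennreal ((c / (1 + c * max 0 q / 2))\<^sup>2 / 2) \<partial>lborel) = ennreal c"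
    if t: "0 \<le> t" for t
  proof -
    have "(\<integral>\<^sup>+q\<in>{0..t}. ennreal ((c / (1 + c * max 0 q / 2))\<^sup>2 / 2) \<partial>lborel) =
      (\<integral>\<^sup>+q. ennreal ((c / (1 + c * q / 2))\<^sup>2 / 2) * indicator {0..t} q \<partial>lborel)"
      by (intro nn_integral_cong) (auto simp: indicator_def)
    also have "\<dots> = ennreal (- (c / (1 + c * t / 2)) - - (c / (1 + c * 0 / 2)))"
    proof (intro nn_integral_FTC_Icc)
      fix q assume "q \<in> {0..t}"
      then have "1 + c * q / 2 \<noteq> 0" using pos[of q] by auto
      then show "DERIV (\<lambda>q. - (c / (1 + c * q / 2))) q :> (c / (1 + c * q / 2))\<^sup>2 / 2"
        by (auto intro!: derivative_eq_intros simp: power2_eq_square)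
    qed (use t in auto)
    also have "ennreal (c / (1 + c * t / 2)) + \<dots> = ennreal (c / (1 + c * t / 2) + (- (c / (1 + c * t / 2)) - - (c / (1 + c * 0 / 2))))"
      using c t pos[OF t] by (intro ennreal_plus[symmetric]) (auto simp: field_simps)
    finally show ?thesis by simp
  qed
  then show ?thesis
    unfolding mild_def using c by auto
qed

text \<open>By uniqueness the solution is the explicit one. The bound does not depend on
  \<open>c\<close>; it yields the factor \<open>1 / t\<close> in
  \<open>extinction_le\<close>.\<close>

lemma mild_const_le:
  assumes V: "mild (\<lambda>_. c) V" and c: "0 \<le> c" and t: "0 < t"
  shows "V t x \<le> 2 / t"
proof -
  have "V t x = c / (1 + c * max 0 t / 2)"
    by (rule mild_unique[OF V mild_const]) (use c t in auto)
  also have "\<dots> \<le> 2 / t"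
  proof -
    have "0 < 1 + c * t / 2" using c t by (simp add: add_pos_nonneg)
    moreover have "c * t \<le> 2 * (1 + c * t / 2)" by simp
    ultimately show ?thesis using t by (simp add: divide_le_eq pos_le_divide_eq mult.commute mult.left_commute)
  qed
  finally show ?thesis .
qed


subsection \<open>Measurability on the space of finite measures\<close>

lemma topspace_weak_topology: "topspace weak_topology = finite_borel_measures"
proof -
  let ?G = "{{\<mu> \<in> finite_borel_measures. (LINT x|\<mu>. \<phi> x) \<in> U} | \<phi> U.
        continuous_on UNIV \<phi> \<and> bounded (range \<phi>) \<and> open (U :: real set)}"
  have "{\<mu> \<in> finite_borel_measures. (LINT x|\<mu>. (0::real)) \<in> UNIV} \<in> ?G"
    by (intro CollectI exI[of _ "\<lambda>_. 0"] exI[of _ UNIV]) auto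
  then have "\<Union>?G = finite_borel_measures"
    by (intro antisym Union_least Union_upper) auto
  then show ?thesis
    by (simp add: weak_topology_def topology_generated_by_topspace)
qed

lemma space_weak_borel: "space weak_borel = finite_borel_measures"
  and sets_weak_borel_openin: "openin weak_topology U \<Longrightarrow> U \<in> sets weak_borel"
proof -
  have "{U. openin weak_topology U} \<subseteq> Pow finite_borel_measures"
    using openin_subset by (fastforce simp: topspace_weak_topology)
  then show "space weak_borel = finite_borel_measures"
    and "openin weak_topology U \<Longrightarrow> U \<in> sets weak_borel"
    by (auto simp: weak_borel_def space_measure_of_conv)
qed

lemma measurable_weak_borel_continuous:
  fixes \<phi> :: "real \<Rightarrow> real"
  assumes "continuous_on UNIV \<phi>" "bounded (range \<phi>)"
  shows "(\<lambda>\<nu>. LINT x|\<nu>. \<phi> x) \<in> borel_measurable weak_borel"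
proof (rule borel_measurableI)
  fix U :: "real set" assume "open U"
  then have "openin weak_topology {\<mu> \<in> finite_borel_measures. (LINT x|\<mu>. \<phi> x) \<in> U}"
    unfolding weak_topology_def using assms by (intro topology_generated_by_Basis) auto
  then show "(\<lambda>\<nu>. LINT x|\<nu>. \<phi> x) -` U \<inter> space weak_borel \<in> sets weak_borel"
    by (auto dest!: sets_weak_borel_openin simp: space_weak_borel vimage_def Int_def conj_commute)
qed

lemma finite_borel_measuresD:
  assumes "\<nu> \<in> finite_borel_measures"
  shows "finite_measure \<nu>" "sets \<nu> = sets borel" "space \<nu> = UNIV"
  using assms by (auto simp: finite_borel_measures_def dest: sets_eq_imp_space_eq)

lemma borel_measurable_weak:
  "\<nu> \<in> space weak_borel \<Longrightarrow> f \<in> borel_measurable borel \<Longrightarrow> f \<in> borel_measurable \<nu>"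
  by (subst measurable_cong_sets[of \<nu> borel]) (auto simp: space_weak_borel finite_borel_measuresD)

lemma integrable_finite_borel:
  assumes \<nu>: "\<nu> \<in> finite_borel_measures" and [measurable]: "\<phi> \<in> borel_measurable borel"
    and B: "\<And>x. \<bar>\<phi> x\<bar> \<le> B"
  shows "integrable \<nu> (\<phi> :: real \<Rightarrow> real)"
proof -
  interpret finite_measure \<nu> by (rule finite_borel_measuresD[OF \<nu>])
  have [measurable_cong]: "sets \<nu> = sets borel" by (rule finite_borel_measuresD[OF \<nu>])
  show ?thesis using B by (intro integrable_const_bound[of _ B]) auto
qed

text \<open>The indicator of a closed half-line is the pointwise limit of continuous ramps that
  vanish to the left of \<open>x - 1 / n\<close> and equal \<open>1\<close> from \<open>x\<close>
  on; dominated convergence under the finite measure does the rest.\<close>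

lemma measurable_weak_borel_atLeast:
  "(\<lambda>\<nu>. measure \<nu> {x::real..}) \<in> borel_measurable weak_borel"
proof (rule borel_measurable_LIMSEQ_real)
  let ?\<phi> = "\<lambda>n y. min 1 (max 0 (1 + real n * (y - x)))"
  show "(\<lambda>\<nu>. LINT y|\<nu>. ?\<phi> n y) \<in> borel_measurable weak_borel" for n
    by (intro measurable_weak_borel_continuous continuous_intros) (auto intro!: boundedI[of _ 1])
  fix \<nu> :: "real measure" assume "\<nu> \<in> space weak_borel"
  then have \<nu>: "\<nu> \<in> finite_borel_measures" by (simp add: space_weak_borel)
  interpret finite_measure \<nu> by (rule finite_borel_measuresD[OF \<nu>])
  have [measurable_cong]: "sets \<nu> = sets borel" by (rule finite_borel_measuresD[OF \<nu>])
  have lim: "(\<lambda>n. ?\<phi> n y) \<longlonglongrightarrow> indicator {x..} y" for y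
  proof (cases "x \<le> y")
    case False
    have "eventually (\<lambda>n. real n \<ge> 1 / (x - y)) sequentially"
      by (intro eventually_compose_filterlim[OF eventually_ge_at_top filterlim_real_sequentially])
    then have "eventually (\<lambda>n. ?\<phi> n y = indicator {x..} y) sequentially"
      using False by (auto elim!: eventually_mono simp: field_simps)
    then show ?thesis by (rule tendsto_eventually)
  qed (auto simp: min_def max_def)
  have "(\<lambda>n. LINT y|\<nu>. ?\<phi> n y) \<longlonglongrightarrow> (LINT y|\<nu>. indicator {x..} y)"
    by (rule integral_dominated_convergence[where w = "\<lambda>_. 1"]) (auto intro: lim)
  then show "(\<lambda>n. LINT y|\<nu>. ?\<phi> n y) \<longlonglongrightarrow> measure \<nu> {x..}"
    using finite_borel_measuresD[OF \<nu>] by simp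
qed

text \<open>Closed half-lines form an intersection-stable generator of the Borel sets, so a Dynkin
  argument extends measurability from them. The total mass comes first because complements require
  it.\<close>

lemma measurable_weak_borel_emeasure:
  assumes "A \<in> sets (borel :: real measure)"
  shows "(\<lambda>\<nu>. emeasure \<nu> A) \<in> borel_measurable weak_borel"
proof -
  have em: "emeasure \<nu> A = ennreal (measure \<nu> A)" if "\<nu> \<in> space weak_borel" for \<nu> A
    using finite_borel_measuresD(1)[of \<nu>] that
    by (simp add: space_weak_borel finite_measure.emeasure_eq_measure)
  have UN: "(\<lambda>\<nu>. emeasure \<nu> (UNIV :: real set)) \<in> borel_measurable weak_borel"
  proof -
    have "(\<lambda>\<nu>. LINT x|\<nu>. (1::real)) \<in> borel_measurable weak_borel"
      by (rule measurable_weak_borel_continuous) auto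
    then have "(\<lambda>\<nu>. ennreal (LINT x|\<nu>. (1::real))) \<in> borel_measurable weak_borel"
      by simp
    also have "?this \<longleftrightarrow> ?thesis"
      by (rule measurable_cong) (simp add: em, simp add: space_weak_borel finite_borel_measuresD)
    finally show ?thesis .
  qed
  have "Int_stable (range (\<lambda>x::real. {x..}))"
  proof (rule Int_stableI_image)
    fix a b :: real
    have "{a..} \<inter> {b..} = {max a b..}" by auto
    then show "\<exists>c\<in>UNIV. {a..} \<inter> {b..} = {c..}" by blast
  qed
  moreover have "range (\<lambda>x::real. {x..}) \<subseteq> Pow UNIV" by simp
  moreover have "A \<in> sigma_sets UNIV (range (\<lambda>x::real. {x..}))"
    using assms by (simp add: borel_Ici)
  ultimately show ?thesis
  proof (induction rule: sigma_sets_induct_disjoint)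
    case (basic B)
    then obtain x where B: "B = {x..}" by auto
    have "(\<lambda>\<nu>. ennreal (measure \<nu> {x..})) \<in> borel_measurable weak_borel"
      using measurable_weak_borel_atLeast by simp
    then show ?case
      unfolding B by (rule measurable_cong[THEN iffD2, rotated]) (simp add: em)
  next
    case (compl B)
    note [measurable] = compl(2) UN
    have B: "B \<in> sets borel" using compl(1) by (simp add: borel_Ici)
    have "(\<lambda>\<nu>. emeasure \<nu> UNIV - emeasure \<nu> B) \<in> borel_measurable weak_borel" by measurable
    also have "?this \<longleftrightarrow> ?case"
    proof (intro measurable_cong)
      fix \<nu> assume \<nu>: "\<nu> \<in> space weak_borel"
      then have "space \<nu> = UNIV" "B \<in> sets \<nu>" using B by (auto simp: space_weak_borel finite_borel_measuresD)
      then show "emeasure \<nu> UNIV - emeasure \<nu> B = emeasure \<nu> (UNIV - B)"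
        using emeasure_compl[of B \<nu>] em[OF \<nu>, of B] by simp
    qed
    finally show ?case .
  next
    case (union B)
    have B: "B i \<in> sets borel" for i using union(2) by (auto simp: borel_Ici)
    have "(\<lambda>\<nu>. \<Sum>i. emeasure \<nu> (B i)) \<in> borel_measurable weak_borel" 
      using union(3) by measurable
    also have "?this \<longleftrightarrow> ?case"
      using B union(1) by (intro measurable_cong suminf_emeasure) (auto simp: space_weak_borel finite_borel_measuresD)
    finally show ?case .
  qed simp_all
qed

lemma measurable_weak_borel_nn_integral:
  assumes "f \<in> borel_measurable (borel :: real measure)"
  shows "(\<lambda>\<nu>. \<integral>\<^sup>+x. f x \<partial>\<nu>) \<in> borel_measurable weak_borel"
  using assms
proof (induction rule: borel_measurable_induct)
  case (cong f g)
  then have "f = g" by auto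
  then show ?case using cong by simp
next
  case (set A)
  then show ?case
    using measurable_weak_borel_emeasure[OF set]
    by (subst measurable_cong[where g = "\<lambda>\<nu>. emeasure \<nu> A"]) (auto simp: space_weak_borel finite_borel_measuresD)
next
  case (mult f c)
  note [measurable] = mult(4)
  have "(\<lambda>\<nu>. c * (\<integral>\<^sup>+x. f x \<partial>\<nu>)) \<in> borel_measurable weak_borel" by measurable
  also have "?this \<longleftrightarrow> ?case"
    using mult by (intro measurable_cong nn_integral_cmult[symmetric]) (auto intro: borel_measurable_weak)
  finally show ?case .
next
  case (add f g)
  note [measurable] = add(3,6)
  have "(\<lambda>\<nu>. (\<integral>\<^sup>+x. g x \<partial>\<nu>) + (\<integral>\<^sup>+x. f x \<partial>\<nu>)) \<in> borel_measurable weak_borel" using add by measurable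
  also have "?this \<longleftrightarrow> ?case"
    using add by (intro measurable_cong nn_integral_add[symmetric]) (auto intro: borel_measurable_weak)
  finally show ?case .
next
  case (seq U)
  have f: "\<Squnion> (range U) = (\<lambda>x. SUP i. U i x)" by (simp add: fun_eq_iff image_comp)
  have "(\<lambda>\<nu>. SUP i. \<integral>\<^sup>+x. U i x \<partial>\<nu>) \<in> borel_measurable weak_borel" using seq by measurable
  also have "?this \<longleftrightarrow> (\<lambda>\<nu>. \<integral>\<^sup>+x. (SUP i. U i x) \<partial>\<nu>) \<in> borel_measurable weak_borel"
    using seq(1,3) by (intro measurable_cong nn_integral_monotone_convergence_SUP[symmetric]) (auto intro: borel_measurable_weak)
  finally show ?case unfolding f .
qed

text \<open>Test functions need not be continuous, so the generators of the weak topology do not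
  apply directly; the nonnegative integral is used instead.\<close>

lemma measurable_weak_borel_integral:
  assumes "test_function \<phi>"
  shows "(\<lambda>\<nu>. LINT x|\<nu>. \<phi> x) \<in> borel_measurable weak_borel"
proof -
  have \<phi>[measurable]: "\<phi> \<in> borel_measurable borel" and nn: "\<And>x. 0 \<le> \<phi> x"
    using assms by (auto simp: test_function_def)
  have "(\<lambda>\<nu>. enn2real (\<integral>\<^sup>+x. ennreal (\<phi> x) \<partial>\<nu>)) \<in> borel_measurable weak_borel"
    using measurable_weak_borel_nn_integral[of "\<lambda>x. ennreal (\<phi> x)"] by simp
  also have "?this \<longleftrightarrow> ?thesis"
    using nn by (intro measurable_cong integral_eq_nn_integral[symmetric])
      (auto intro: borel_measurable_weak)
  finally show ?thesis .
qed

lemma measurable_path_eval: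
  assumes "0 \<le> t"
  shows "(\<lambda>\<omega>. \<omega> t) \<in> path_space \<rightarrow>\<^sub>M weak_borel"
  unfolding path_space_def
  by (rule measurable_restrict_space1[OF measurable_component_singleton]) (use assms in simp)

section \<open>Test functions and comparison of solutions\<close>

lemma test_functionI:
  "\<phi> \<in> borel_measurable borel \<Longrightarrow> (\<And>x. 0 \<le> \<phi> x) \<Longrightarrow> (\<And>x. \<phi> x \<le> B) \<Longrightarrow> test_function \<phi>"
  by (auto simp: test_function_def intro!: boundedI[of _ B])

lemma test_functionE:
  assumes "test_function \<phi>"
  obtains B where "\<phi> \<in> borel_measurable borel" "\<And>x. 0 \<le> \<phi> x" "\<And>x. \<phi> x \<le> B" "0 \<le> B"
proof -
  have \<phi>: "\<phi> \<in> borel_measurable borel" "\<And>x. 0 \<le> \<phi> x" using assms by (auto simp: test_function_def)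
  have "bounded (range \<phi>)" using assms by (simp add: test_function_def)
  then obtain B where "\<forall>y\<in>range \<phi>. norm y \<le> B" unfolding bounded_iff by blast
  then have B: "\<bar>\<phi> x\<bar> \<le> B" for x by simp
  show ?thesis
    using \<phi> abs_le_D1[OF B] order_trans[OF abs_ge_zero B] by (rule that)
qed

lemma test_function_add_scaled:
  assumes "test_function \<phi>" "test_function \<psi>" "0 \<le> c"
  shows "test_function (\<lambda>x. \<phi> x + c * \<psi> x)"
proof -
  obtain A where A: "\<phi> \<in> borel_measurable borel" "\<And>x. 0 \<le> \<phi> x" "\<And>x. \<phi> x \<le> A"
    using assms(1) by (elim test_functionE) blast
  obtain B where B: "\<psi> \<in> borel_measurable borel" "\<And>x. 0 \<le> \<psi> x" "\<And>x. \<psi> x \<le> B"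
    using assms(2) by (elim test_functionE) blast
  show ?thesis
    using A B assms(3) by (intro test_functionI[of _ "A + c * B"] add_mono mult_left_mono) auto
qed

lemma integrable_test_function:
  "\<nu> \<in> finite_borel_measures \<Longrightarrow> test_function \<phi> \<Longrightarrow> integrable \<nu> \<phi>"
  by (elim test_functionE, rule integrable_finite_borel) (auto simp: abs_le_iff intro: order_trans)

lemma test_function_mild:
  assumes "test_function \<phi>" "mild \<phi> V" "0 \<le> t"
  shows "test_function (V t)"
proof -
  obtain B where B: "\<phi> \<in> borel_measurable borel" "\<And>x. 0 \<le> \<phi> x" "\<And>x. \<phi> x \<le> B" "0 \<le> B"
    using assms(1) by (elim test_functionE) blast
  show ?thesis
    using mild_measurable'[OF assms(2)] mild_nonneg[OF assms(2)] mild_le[OF assms(2,3) B(3,4)]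
    by (rule test_functionI)
qed

text \<open>The larger solution also has the larger quadratic loss, so its excess is at most the
  linear evolution of the perturbation \<open>c * \<psi>\<close>.\<close>

lemma mild_perturbation_le:
  assumes V: "mild \<phi> V" and W: "mild (\<lambda>x. \<phi> x + c * \<psi> x) W" and \<phi>: "test_function \<phi>" and \<psi>: "test_function \<psi>"
    and c: "0 \<le> c" and s: "0 \<le> s" and le: "\<And>q y. 0 \<le> q \<Longrightarrow> V q y \<le> W q y"
    and \<eta>: "ennreal (\<eta> x) = heat s (\<lambda>y. ennreal (\<psi> y)) x" "0 \<le> \<eta> x"
  shows "W s x \<le> V s x + c * \<eta> x"
proof -
  obtain B where B: "\<phi> \<in> borel_measurable borel" "\<And>x. 0 \<le> \<phi> x"
    using \<phi> by (elim test_functionE) blast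
  obtain B' where B': "\<psi> \<in> borel_measurable borel" "\<And>x. 0 \<le> \<psi> x"
    using \<psi> by (elim test_functionE) blast
  obtain C where C: "\<And>x. \<phi> x + c * \<psi> x \<le> C" "0 \<le> C"
    using test_function_add_scaled[OF \<phi> \<psi> c] by (elim test_functionE) blast
  note [measurable] = B(1) B'(1)
  let ?J = "\<lambda>V. \<integral>\<^sup>+q\<in>{0..s}. heat (s - q) (\<lambda>y. ennreal ((V q y)\<^sup>2 / 2)) x \<partial>lborel"
  have "?J W + ennreal (W s x) = heat s (\<lambda>y. ennreal (\<phi> y) + ennreal c * ennreal (\<psi> y)) x"
    using mild_eq[OF W s, of x] c B B' by (simp add: ennreal_mult add.commute)
  also have "\<dots> = heat s (\<lambda>y. ennreal (\<phi> y)) x + ennreal c * heat s (\<lambda>y. ennreal (\<psi> y)) x"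
    by (subst heat_add) (auto simp: heat_cmult)
  also have "\<dots> = ennreal (V s x) + ?J V + ennreal (c * \<eta> x)"
    using mild_eq[OF V s, of x] c \<eta> by (simp add: ennreal_mult)
  also have "\<dots> \<le> ennreal (V s x) + ?J W + ennreal (c * \<eta> x)"
    using le mild_nonneg[OF V]
    by (intro add_right_mono add_left_mono nn_integral_mono) (auto simp: indicator_def intro!: heat_mono ennreal_leI divide_right_mono power_mono)
  also have "\<dots> = ?J W + ennreal (V s x + c * \<eta> x)"
    using c \<eta>(2) mild_nonneg[OF V, of s x] by (simp add: ac_simps)
  finally have "ennreal (W s x) \<le> ennreal (V s x + c * \<eta> x)"
    using mild_integral_finite[OF W s C, of x] by (subst (asm) ennreal_add_left_cancel_le) auto
  then show ?thesis
    using c \<eta>(2) mild_nonneg[OF V, of s x] by (subst (asm) ennreal_le_iff) auto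
qed

text \<open>The time integral runs over a single point. This covers time \<open>0\<close>, about
  which the Laplace formula of the canonical measures says nothing.\<close>

lemma mild_initial:
  assumes "mild \<phi> V" "0 \<le> \<phi> x"
  shows "V 0 x = \<phi> x"
proof -
  have "(\<integral>\<^sup>+q\<in>{0..0}. heat (0 - q) (\<lambda>y. ennreal ((V q y)\<^sup>2 / 2)) x \<partial>lborel) = (\<integral>\<^sup>+q. 0 \<partial>(lborel :: real measure))"
    using AE_lborel_singleton[of 0] by (intro nn_integral_cong_AE) (auto elim!: eventually_mono simp: indicator_def)
  then show ?thesis
    using mild_eq[OF assms(1), of 0 x] mild_nonneg[OF assms(1), of 0 x] assms(2) by simp
qed

text \<open>Uniqueness allows every mild solution to stand for the one named in a Laplace
  formula.\<close>

lemma log_laplace_mild_eq: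
  assumes "test_function \<phi>" "log_laplace_solution \<phi> V" "mild \<phi> W" "0 \<le> t"
  shows "W t x = V t x"
proof -
  obtain B where B: "\<And>x. \<phi> x \<le> B" "0 \<le> B" using assms(1) by (elim test_functionE) blast
  show ?thesis
    using mild_unique[OF assms(3) mild_of_log_laplace_solution[OF assms(2,1)] B assms(4), of x] assms(4) by simp
qed

lemma integral_test_function_mono:
  assumes "\<nu> \<in> finite_borel_measures" "test_function \<phi>" "test_function \<psi>" "\<And>x. \<phi> x \<le> \<psi> x"
  shows "(LINT x|\<nu>. \<phi> x) \<le> (LINT x|\<nu>. \<psi> x)"
  using integrable_test_function[OF assms(1,2)] integrable_test_function[OF assms(1,3)] assms(4)
  by (intro integral_mono)


subsection \<open>One-dimensional marginals\<close>

lemma nn_integral_compose_countable: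
  fixes k :: "'a \<Rightarrow> 'b :: countable"
  assumes [measurable]: "k \<in> M \<rightarrow>\<^sub>M count_space UNIV"
  shows "(\<integral>\<^sup>+x. g (k x) \<partial>M) = (\<integral>\<^sup>+i. g i * emeasure M {x \<in> space M. k x = i} \<partial>count_space UNIV)"
proof -
  have "(\<integral>\<^sup>+x. g (k x) \<partial>M) = (\<integral>\<^sup>+x. \<integral>\<^sup>+i. g i * indicator {x \<in> space M. k x = i} x \<partial>count_space UNIV \<partial>M)"
  proof (intro nn_integral_cong)
    fix x assume "x \<in> space M"
    then have "(\<integral>\<^sup>+i. g i * indicator {x \<in> space M. k x = i} x \<partial>count_space UNIV) = (\<integral>\<^sup>+i. g (k x) * indicator {k x} i \<partial>count_space UNIV)"
      by (intro nn_integral_cong) (auto simp: indicator_def)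
    then show "g (k x) = (\<integral>\<^sup>+i. g i * indicator {x \<in> space M. k x = i} x \<partial>count_space UNIV)"
      by (simp add: nn_integral_cmult_indicator)
  qed
  also have "\<dots> = (\<integral>\<^sup>+i. \<integral>\<^sup>+x. g i * indicator {x \<in> space M. k x = i} x \<partial>M \<partial>count_space UNIV)"
    by (rule nn_integral_count_space_nn_integral) auto
  also have "\<dots> = (\<integral>\<^sup>+i. g i * emeasure M {x \<in> space M. k x = i} \<partial>count_space UNIV)"
    by (intro nn_integral_cong nn_integral_cmult_indicator) measurable
  finally show ?thesis .
qed

section \<open>Gaussian tails and difference quotients\<close>

text \<open>The factor \<open>1 / 2\<close> absorbs the loss in \<open>mild_half_heat_le\<close>, so
  that \<open>gauss_tail a / s\<close> is directly a lower bound for a solution.\<close>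

definition gauss_tail :: "real \<Rightarrow> real" where
  "gauss_tail a = measure gauss {a..} / 2"

lemma gauss_tail_pos: "0 < gauss_tail a"
proof -
  have "emeasure gauss {a..} \<noteq> 0"
  proof
    assume "emeasure gauss {a..} = 0"
    then have "{a..} \<in> null_sets gauss" by (intro null_setsI) auto
    then have "AE x in lborel. x \<in> {a..} \<longrightarrow> ennreal (std_normal_density x) = 0"
      unfolding gauss_def by (subst (asm) null_sets_density_iff) auto
    then have "AE x in lborel. x \<notin> {a..}"
      by eventually_elim (use normal_density_pos[of 1 0] in \<open>auto simp: less_le\<close>)
    then have "emeasure lborel {a..} = 0"
      by (subst (asm) AE_iff_measurable[of "{a..}"]) auto
    moreover have "emeasure lborel {a..a+1} \<le> emeasure lborel {a..}"
      by (intro emeasure_mono) auto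
    ultimately show False by simp
  qed
  then show ?thesis
    by (auto simp: gauss_tail_def gauss.emeasure_eq_measure less_le)
qed

lemma gauss_tail_le: "gauss_tail a \<le> 1 / 2"
  by (simp add: gauss_tail_def)

lemma gauss_tail_antimono: "a \<le> b \<Longrightarrow> gauss_tail b \<le> gauss_tail a"
  by (auto simp: gauss_tail_def intro!: gauss.finite_measure_mono)

text \<open>The integrand in the conclusion is the derivative at \<open>\<theta> = 0\<close> of the
  one in \<open>le\<close>. Fatou's lemma along \<open>\<theta> = 1 / (n + 1)\<close> gives the
  inequality without a dominating function.\<close>

lemma nn_integral_difference_quotient_le:
  assumes [measurable]: "a \<in> borel_measurable M" "b \<in> borel_measurable M"
    and b: "\<And>x. x \<in> space M \<Longrightarrow> 0 \<le> b x"
    and le: "\<And>\<theta>. 0 < \<theta> \<Longrightarrow> (\<integral>\<^sup>+x. ennreal (exp (- a x) * (1 - exp (- (\<theta> * b x)))) \<partial>M) \<le> ennreal \<theta> * K"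
  shows "(\<integral>\<^sup>+x. ennreal (b x * exp (- a x)) \<partial>M) \<le> K"
proof -
  let ?f = "\<lambda>n x. ennreal (real (Suc n)) * ennreal (exp (- a x) * (1 - exp (- (inverse (real (Suc n)) * b x))))"
  have lim: "(\<lambda>n. ?f n x) \<longlonglongrightarrow> ennreal (b x * exp (- a x))" if x: "x \<in> space M" for x
  proof -
    have "((\<lambda>\<theta>. exp (- a x) * (1 - exp (- (\<theta> * b x)))) has_field_derivative b x * exp (- a x)) (at 0)"
      by (auto intro!: derivative_eq_intros)
    then have "((\<lambda>\<theta>. exp (- a x) * (1 - exp (- (\<theta> * b x))) / \<theta>) \<longlongrightarrow> b x * exp (- a x)) (at 0)"
      by (simp add: has_field_derivative_iff)
    moreover have "filterlim (\<lambda>n. inverse (real (Suc n))) (at 0) sequentially"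
      by (intro filterlim_atI LIMSEQ_inverse_real_of_nat) auto
    ultimately have "(\<lambda>n. exp (- a x) * (1 - exp (- (inverse (real (Suc n)) * b x))) / inverse (real (Suc n))) \<longlonglongrightarrow> b x * exp (- a x)"
      by (rule filterlim_compose)
    then have "(\<lambda>n. ennreal (exp (- a x) * (1 - exp (- (inverse (real (Suc n)) * b x))) / inverse (real (Suc n)))) \<longlonglongrightarrow> ennreal (b x * exp (- a x))"
      by (rule tendsto_ennrealI)
    also have "(\<lambda>n. ennreal (exp (- a x) * (1 - exp (- (inverse (real (Suc n)) * b x))) / inverse (real (Suc n)))) = (\<lambda>n. ?f n x)"
      using b[OF x] by (intro ext, subst ennreal_mult[symmetric]) (auto simp: field_simps)
    finally show ?thesis .
  qed
  have "(\<integral>\<^sup>+x. ennreal (b x * exp (- a x)) \<partial>M) = (\<integral>\<^sup>+x. liminf (\<lambda>n. ?f n x) \<partial>M)"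
    using lim_imp_Liminf[OF sequentially_bot lim] by (intro nn_integral_cong) simp
  also have "\<dots> \<le> liminf (\<lambda>n. \<integral>\<^sup>+x. ?f n x \<partial>M)"
    by (rule nn_integral_liminf) measurable
  also have "\<dots> \<le> liminf (\<lambda>n. K)"
  proof (intro Liminf_mono always_eventually allI)
    fix n
    have "(\<integral>\<^sup>+x. ?f n x \<partial>M) = ennreal (real (Suc n)) * (\<integral>\<^sup>+x. ennreal (exp (- a x) * (1 - exp (- (inverse (real (Suc n)) * b x)))) \<partial>M)"
      by (rule nn_integral_cmult) measurable
    also have "\<dots> \<le> ennreal (real (Suc n)) * (ennreal (inverse (real (Suc n))) * K)"
      by (intro mult_left_mono le) auto
    also have "\<dots> = K"
      by (simp add: mult.assoc[symmetric] ennreal_mult[symmetric] del: of_nat_Suc)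
    finally show "(\<integral>\<^sup>+x. ?f n x \<partial>M) \<le> K" .
  qed
  finally show ?thesis by (simp add: Liminf_const)
qed

section \<open>Laplace functionals and first moments at fixed times\<close>

text \<open>\<open>G\<close> turns the solution at time \<open>t\<close> into the integral of
  \<open>1 - exp\<close>, and \<open>m\<close> stands for the initial mass. It is
  \<open>1 - exp\<close> that is integrated because \<open>M\<close> need not be finite.\<close>

locale superprocess_marginals =
  fixes M :: "'w measure" and Y :: "real \<Rightarrow> 'w \<Rightarrow> real measure"
    and G :: "(real \<Rightarrow> real) \<Rightarrow> ennreal" and m :: real
  assumes measurable_Y: "0 < t \<Longrightarrow> Y t \<in> M \<rightarrow>\<^sub>M weak_borel"
    and laplace: "test_function \<phi> \<Longrightarrow> mild \<phi> V \<Longrightarrow> 0 < t \<Longrightarrow>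
      (\<integral>\<^sup>+\<omega>. ennreal (1 - exp (- (LINT x|Y t \<omega>. \<phi> x))) \<partial>M) = G (V t)"
    and mild_ex: "test_function \<phi> \<Longrightarrow> \<exists>V. mild \<phi> V"
    and mild_mono: "test_function \<phi> \<Longrightarrow> test_function \<psi> \<Longrightarrow> (\<And>x. \<phi> x \<le> \<psi> x) \<Longrightarrow>
      mild \<phi> V \<Longrightarrow> mild \<psi> W \<Longrightarrow> 0 \<le> t \<Longrightarrow> V t x \<le> W t x"
    and G_le: "f \<in> borel_measurable borel \<Longrightarrow> (\<And>x. 0 \<le> f x) \<Longrightarrow> (\<And>x. f x \<le> c) \<Longrightarrow> G f \<le> ennreal (m * c)"
    and m_nonneg: "0 \<le> m"
begin

lemma Y_finite: "0 < t \<Longrightarrow> \<omega> \<in> space M \<Longrightarrow> Y t \<omega> \<in> finite_borel_measures"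
  using measurable_space[OF measurable_Y] by (simp add: space_weak_borel)

lemma measurable_Y_integral: "0 < t \<Longrightarrow> test_function \<phi> \<Longrightarrow> (\<lambda>\<omega>. LINT x|Y t \<omega>. \<phi> x) \<in> borel_measurable M"
  by (rule measurable_compose[OF measurable_Y measurable_weak_borel_integral])

lemma Y_integral_nonneg: "test_function \<phi> \<Longrightarrow> 0 \<le> (LINT x|Y t \<omega>. \<phi> x)"
  by (auto simp: test_function_def intro!: integral_nonneg_AE)

text \<open>The flow property moves a test from time \<open>r + s\<close> back to time
  \<open>r\<close>. It serves in place of a Markov property.\<close>

lemma laplace_shift:
  assumes \<phi>: "test_function \<phi>" and V: "mild \<phi> V" and r: "0 < r" and s: "0 \<le> s"
  shows "(\<integral>\<^sup>+\<omega>. ennreal (1 - exp (- (LINT x|Y (r + s) \<omega>. \<phi> x))) \<partial>M) = (\<integral>\<^sup>+\<omega>. ennreal (1 - exp (- (LINT x|Y r \<omega>. V s x))) \<partial>M)"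
proof -
  obtain B where B: "\<phi> \<in> borel_measurable borel" "\<And>x. 0 \<le> \<phi> x" "\<And>x. \<phi> x \<le> B" "0 \<le> B"
    using \<phi> by (elim test_functionE) blast
  show ?thesis
    using laplace[OF \<phi> V, of "r + s"] laplace[OF test_function_mild[OF \<phi> V s] mild_shift[OF V B(1,3,4) s] r] r s
    by (simp add: add.commute)
qed

text \<open>The solution is bounded, so \<open>G_le\<close> applies. Finiteness allows the Laplace
  functional to be cancelled in \<open>moment_step\<close>.\<close>

lemma laplace_finite:
  assumes \<phi>: "test_function \<phi>" and t: "0 < t"
  shows "(\<integral>\<^sup>+\<omega>. ennreal (1 - exp (- (LINT x|Y t \<omega>. \<phi> x))) \<partial>M) < \<infinity>"
proof -
  obtain B where B: "\<phi> \<in> borel_measurable borel" "\<And>x. 0 \<le> \<phi> x" "\<And>x. \<phi> x \<le> B" "0 \<le> B"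
    using \<phi> by (elim test_functionE) blast
  obtain V where V: "mild \<phi> V" using mild_ex[OF \<phi>] by blast
  have "G (V t) \<le> ennreal (m * B)"
    using mild_measurable'[OF V] mild_nonneg[OF V] mild_le[OF V _ B(3,4)] t by (intro G_le) auto
  then show ?thesis
    using laplace[OF \<phi> V t] by (simp add: order_le_less_trans)
qed

text \<open>Pointwise, \<open>1 - exp (- (a + c * b))\<close> is the sum of
  \<open>1 - exp (- a)\<close> and \<open>exp (- a) * (1 - exp (- (c * b)))\<close>. The additive
  form avoids subtracting integrals in \<open>ennreal\<close>.\<close>

lemma laplace_add:
  assumes \<phi>: "test_function \<phi>" and \<psi>: "test_function \<psi>" and t: "0 < t" and c: "0 \<le> c"
  shows "(\<integral>\<^sup>+\<omega>. ennreal (1 - exp (- (LINT x|Y t \<omega>. \<phi> x + c * \<psi> x))) \<partial>M) =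
    (\<integral>\<^sup>+\<omega>. ennreal (1 - exp (- (LINT x|Y t \<omega>. \<phi> x))) \<partial>M) +
    (\<integral>\<^sup>+\<omega>. ennreal (exp (- (LINT x|Y t \<omega>. \<phi> x)) * (1 - exp (- (c * (LINT x|Y t \<omega>. \<psi> x))))) \<partial>M)"
proof (subst nn_integral_add[symmetric])
  note [measurable] = measurable_Y_integral[OF t \<phi>] measurable_Y_integral[OF t \<psi>]
  show "(\<lambda>\<omega>. ennreal (1 - exp (- (LINT x|Y t \<omega>. \<phi> x)))) \<in> borel_measurable M"
    "(\<lambda>\<omega>. ennreal (exp (- (LINT x|Y t \<omega>. \<phi> x)) * (1 - exp (- (c * (LINT x|Y t \<omega>. \<psi> x)))))) \<in> borel_measurable M"
    by measurable
  show "(\<integral>\<^sup>+\<omega>. ennreal (1 - exp (- (LINT x|Y t \<omega>. \<phi> x + c * \<psi> x))) \<partial>M) =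
    (\<integral>\<^sup>+\<omega>. ennreal (1 - exp (- (LINT x|Y t \<omega>. \<phi> x))) + ennreal (exp (- (LINT x|Y t \<omega>. \<phi> x)) * (1 - exp (- (c * (LINT x|Y t \<omega>. \<psi> x))))) \<partial>M)"
  proof (intro nn_integral_cong)
    fix \<omega> assume "\<omega> \<in> space M"
    then have fin: "Y t \<omega> \<in> finite_borel_measures" using t by (rule Y_finite[rotated])
    let ?a = "LINT x|Y t \<omega>. \<phi> x" and ?b = "LINT x|Y t \<omega>. \<psi> x"
    have "(LINT x|Y t \<omega>. \<phi> x + c * \<psi> x) = ?a + c * ?b"
      using integrable_test_function[OF fin \<phi>] integrable_test_function[OF fin \<psi>] by simp
    moreover have "0 \<le> ?a" "0 \<le> c * ?b" using \<phi> \<psi> c by (auto simp: Y_integral_nonneg)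
    moreover have "1 - exp (- (?a + c * ?b)) = (1 - exp (- ?a)) + exp (- ?a) * (1 - exp (- (c * ?b)))"
      by (simp add: algebra_simps exp_add[symmetric])
    ultimately show "ennreal (1 - exp (- (LINT x|Y t \<omega>. \<phi> x + c * \<psi> x))) =
      ennreal (1 - exp (- ?a)) + ennreal (exp (- ?a) * (1 - exp (- (c * ?b))))"
      by (simp add: ennreal_plus[symmetric] del: ennreal_plus)
  qed
qed

text \<open>Both sides are compared through the difference quotients in \<open>\<theta>\<close>, at \<open>\<theta> = 0\<close>, of the Laplace
  functional of \<open>\<phi> + \<theta> \<psi>\<close>.\<close>

lemma moment_step:
  assumes \<phi>: "test_function \<phi>" and \<psi>: "test_function \<psi>" and V: "mild \<phi> V" and r: "0 < r" and s: "0 \<le> s"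
    and \<eta>: "test_function \<eta>" "\<And>x. ennreal (\<eta> x) = heat s (\<lambda>y. ennreal (\<psi> y)) x"
  shows "(\<integral>\<^sup>+\<omega>. ennreal ((LINT x|Y (r + s) \<omega>. \<psi> x) * exp (- (LINT x|Y (r + s) \<omega>. \<phi> x))) \<partial>M)
    \<le> (\<integral>\<^sup>+\<omega>. ennreal ((LINT x|Y r \<omega>. \<eta> x) * exp (- (LINT x|Y r \<omega>. V s x))) \<partial>M)"
proof (rule nn_integral_difference_quotient_le)
  have t: "0 < r + s" using r s by simp
  show "(\<lambda>\<omega>. LINT x|Y (r + s) \<omega>. \<phi> x) \<in> borel_measurable M" "(\<lambda>\<omega>. LINT x|Y (r + s) \<omega>. \<psi> x) \<in> borel_measurable M"
    using measurable_Y_integral t \<phi> \<psi> by auto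
  show "0 \<le> (LINT x|Y (r + s) \<omega>. \<psi> x)" for \<omega> using \<psi> by (rule Y_integral_nonneg)
  fix \<theta> :: real assume \<theta>: "0 < \<theta>"
  have \<phi>\<psi>: "test_function (\<lambda>x. \<phi> x + \<theta> * \<psi> x)" using \<phi> \<psi> \<theta> by (intro test_function_add_scaled) auto
  obtain W where W: "mild (\<lambda>x. \<phi> x + \<theta> * \<psi> x) W" using mild_ex[OF \<phi>\<psi>] by blast
  have Vs: "test_function (V s)" and Ws: "test_function (W s)"
    using test_function_mild[OF \<phi> V s] test_function_mild[OF \<phi>\<psi> W s] by auto
  have le: "V q y \<le> W q y" if "0 \<le> q" for q y
    using \<psi> \<theta> by (intro mild_mono[OF \<phi> \<phi>\<psi> _ V W that]) (auto simp: test_function_def)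
  \<comment> \<open>Here the nonlinear solution of the perturbed problem is replaced by a linear
    perturbation of \<open>V s\<close>.\<close>
  have W_le: "W s y \<le> V s y + \<theta> * \<eta> y" for y
    by (rule mild_perturbation_le[OF V W \<phi> \<psi> _ s le]) (use \<theta> \<eta> in \<open>auto simp: test_function_def\<close>)
  have V\<eta>: "test_function (\<lambda>x. V s x + \<theta> * \<eta> x)" using Vs \<eta> \<theta> by (intro test_function_add_scaled) auto
  let ?L = "\<integral>\<^sup>+\<omega>. ennreal (1 - exp (- (LINT x|Y (r + s) \<omega>. \<phi> x))) \<partial>M"
  let ?K = "\<integral>\<^sup>+\<omega>. ennreal ((LINT x|Y r \<omega>. \<eta> x) * exp (- (LINT x|Y r \<omega>. V s x))) \<partial>M"
  note [measurable] = measurable_Y_integral[OF r Vs] measurable_Y_integral[OF r \<eta>(1)]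
  have "(\<integral>\<^sup>+\<omega>. ennreal (exp (- (LINT x|Y r \<omega>. V s x)) * (1 - exp (- (\<theta> * (LINT x|Y r \<omega>. \<eta> x))))) \<partial>M)
    \<le> (\<integral>\<^sup>+\<omega>. ennreal \<theta> * ennreal ((LINT x|Y r \<omega>. \<eta> x) * exp (- (LINT x|Y r \<omega>. V s x))) \<partial>M)"
  proof (intro nn_integral_mono)
    fix \<omega>
    let ?a = "LINT x|Y r \<omega>. V s x" and ?b = "LINT x|Y r \<omega>. \<eta> x"
    have "1 - exp (- (\<theta> * ?b)) \<le> \<theta> * ?b" using exp_ge_add_one_self[of "- (\<theta> * ?b)"] by simp
    then have "exp (- ?a) * (1 - exp (- (\<theta> * ?b))) \<le> exp (- ?a) * (\<theta> * ?b)" by (rule mult_left_mono) simp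
    then have "ennreal (exp (- ?a) * (1 - exp (- (\<theta> * ?b)))) \<le> ennreal (\<theta> * (?b * exp (- ?a)))"
      by (intro ennreal_leI) (simp add: ac_simps)
    then show "ennreal (exp (- ?a) * (1 - exp (- (\<theta> * ?b)))) \<le> ennreal \<theta> * ennreal (?b * exp (- ?a))"
      using \<theta> by (simp add: ennreal_mult')
  qed
  also have "\<dots> = ennreal \<theta> * ?K"
    by (rule nn_integral_cmult) measurable
  finally have up: "(\<integral>\<^sup>+\<omega>. ennreal (exp (- (LINT x|Y r \<omega>. V s x)) * (1 - exp (- (\<theta> * (LINT x|Y r \<omega>. \<eta> x))))) \<partial>M) \<le> ennreal \<theta> * ?K" .
  \<comment> \<open>The first and the last expression of this chain both contain \<open>?L\<close>,
    the latter by \<open>laplace_shift\<close> for \<open>\<phi>\<close>, so it cancels and leaves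
    the difference quotients.\<close>
  have "?L + (\<integral>\<^sup>+\<omega>. ennreal (exp (- (LINT x|Y (r + s) \<omega>. \<phi> x)) * (1 - exp (- (\<theta> * (LINT x|Y (r + s) \<omega>. \<psi> x))))) \<partial>M)
    = (\<integral>\<^sup>+\<omega>. ennreal (1 - exp (- (LINT x|Y (r + s) \<omega>. \<phi> x + \<theta> * \<psi> x))) \<partial>M)"
    using \<theta> by (intro laplace_add[OF \<phi> \<psi> t, symmetric]) auto
  also have "\<dots> = (\<integral>\<^sup>+\<omega>. ennreal (1 - exp (- (LINT x|Y r \<omega>. W s x))) \<partial>M)"
    by (rule laplace_shift[OF \<phi>\<psi> W r s])
  also have "\<dots> \<le> (\<integral>\<^sup>+\<omega>. ennreal (1 - exp (- (LINT x|Y r \<omega>. V s x + \<theta> * \<eta> x))) \<partial>M)"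
    using integrable_test_function[OF Y_finite[OF r] Ws] integrable_test_function[OF Y_finite[OF r] V\<eta>] W_le
    by (intro nn_integral_mono ennreal_leI diff_left_mono) (auto intro!: integral_mono)
  also have "\<dots> = (\<integral>\<^sup>+\<omega>. ennreal (1 - exp (- (LINT x|Y r \<omega>. V s x))) \<partial>M) +
    (\<integral>\<^sup>+\<omega>. ennreal (exp (- (LINT x|Y r \<omega>. V s x)) * (1 - exp (- (\<theta> * (LINT x|Y r \<omega>. \<eta> x))))) \<partial>M)"
    using \<theta> by (intro laplace_add[OF Vs \<eta>(1) r]) auto
  also have "(\<integral>\<^sup>+\<omega>. ennreal (1 - exp (- (LINT x|Y r \<omega>. V s x))) \<partial>M) = ?L"
    by (rule laplace_shift[OF \<phi> V r s, symmetric])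
  also note add_left_mono[OF up, of ?L]
  finally show "(\<integral>\<^sup>+\<omega>. ennreal (exp (- (LINT x|Y (r + s) \<omega>. \<phi> x)) * (1 - exp (- (\<theta> * (LINT x|Y (r + s) \<omega>. \<psi> x))))) \<partial>M) \<le> ennreal \<theta> * ?K"
    using laplace_finite[OF \<phi> t] by (subst (asm) ennreal_add_left_cancel_le) auto
qed

text \<open>Differentiating the Laplace functional of the constants \<open>\<theta>\<close> at
  \<open>\<theta> = 0\<close> gives the mean total mass, and \<open>G_le\<close> bounds the
  difference quotients by \<open>m\<close>.\<close>

lemma first_moment_le:
  assumes t: "0 < t"
  shows "(\<integral>\<^sup>+\<omega>. emeasure (Y t \<omega>) UNIV \<partial>M) \<le> ennreal m"
proof -
  have one: "test_function (\<lambda>_. 1)" by (rule test_functionI) auto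
  have int: "(LINT x|Y t \<omega>. c) = c * measure (Y t \<omega>) UNIV" if "\<omega> \<in> space M" for \<omega> c
    using finite_borel_measuresD[OF Y_finite[OF t that]] by simp
  note [measurable] = measurable_Y_integral[OF t one]
  \<comment> \<open>The factor \<open>exp (- 0)\<close> is written out to match the difference
    quotient lemma with \<open>a = 0\<close>.\<close>
  have "(\<integral>\<^sup>+\<omega>. ennreal ((LINT x|Y t \<omega>. 1) * exp (- 0)) \<partial>M) \<le> ennreal m"
  proof (rule nn_integral_difference_quotient_le)
    fix \<theta> :: real assume \<theta>: "0 < \<theta>"
    have c: "test_function (\<lambda>_. \<theta>)" using \<theta> by (intro test_functionI) auto
    obtain V where V: "mild (\<lambda>_. \<theta>) V" using mild_ex[OF c] by blast
    have "(\<integral>\<^sup>+\<omega>. ennreal (exp (- 0) * (1 - exp (- (\<theta> * (LINT x|Y t \<omega>. 1))))) \<partial>M) =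
      (\<integral>\<^sup>+\<omega>. ennreal (1 - exp (- (LINT x|Y t \<omega>. \<theta>))) \<partial>M)"
      by (intro nn_integral_cong) (simp add: int mult.commute)
    also have "\<dots> = G (V t)" by (rule laplace[OF c V t])
    also have "\<dots> \<le> ennreal (m * \<theta>)"
      using mild_measurable'[OF V] mild_nonneg[OF V] mild_le[OF V] t \<theta> by (intro G_le) auto
    finally show "(\<integral>\<^sup>+\<omega>. ennreal (exp (- 0) * (1 - exp (- (\<theta> * (LINT x|Y t \<omega>. 1))))) \<partial>M) \<le> ennreal \<theta> * ennreal m"
      using \<theta> m_nonneg by (simp add: ennreal_mult mult.commute)
  qed (use measurable_Y_integral[OF t one] Y_integral_nonneg[OF one] in \<open>simp_all del: lebesgue_integral_const\<close>)
  also have "(\<integral>\<^sup>+\<omega>. ennreal ((LINT x|Y t \<omega>. 1) * exp (- 0)) \<partial>M) = (\<integral>\<^sup>+\<omega>. emeasure (Y t \<omega>) UNIV \<partial>M)"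
    by (intro nn_integral_cong)
       (simp add: int finite_measure.emeasure_eq_measure finite_borel_measuresD(1,3)[OF Y_finite[OF t]])
  finally show ?thesis .
qed

text \<open>The solution with constant initial value is at most \<open>2 / t\<close> whatever the
  constant, hence uniformity in \<open>c\<close>.\<close>

lemma extinction_le:
  assumes t: "0 < t" and c: "0 < c"
  shows "(\<integral>\<^sup>+\<omega>. ennreal (1 - exp (- (c * measure (Y t \<omega>) UNIV))) \<partial>M) \<le> ennreal (2 * m / t)"
proof -
  have c': "test_function (\<lambda>_. c)" using c by (intro test_functionI) auto
  obtain V where V: "mild (\<lambda>_. c) V" using mild_ex[OF c'] by blast
  have "(\<integral>\<^sup>+\<omega>. ennreal (1 - exp (- (c * measure (Y t \<omega>) UNIV))) \<partial>M) =
      (\<integral>\<^sup>+\<omega>. ennreal (1 - exp (- (LINT x|Y t \<omega>. c))) \<partial>M)"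
    using finite_borel_measuresD[OF Y_finite[OF t]] by (intro nn_integral_cong) (simp add: mult.commute)
  also have "\<dots> = G (V t)" by (rule laplace[OF c' V t])
  also have "\<dots> \<le> ennreal (m * (2 / t))"
    using mild_measurable'[OF V] mild_nonneg[OF V] mild_const_le[OF V _ t] c by (intro G_le) auto
  finally show ?thesis by (simp add: ac_simps)
qed

text \<open>Monotonicity allows the height \<open>l\<close> to be lowered to \<open>1 / s\<close>,
  at which the solution keeps at least half of its linear part over time \<open>s\<close>. The
  linear part is at least the probability of a displacement of \<open>a\<close> or more standard
  deviations, divided by \<open>s\<close>.\<close>

lemma mild_halfline_ge:
  assumes V: "mild (\<lambda>x. l * indicator {z..} x) V" and s: "0 < s" and l: "1 / s \<le> l"
    and x: "z - a * sqrt s \<le> x"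
  shows "gauss_tail a / s \<le> V s x"
proof -
  let ?\<phi> = "\<lambda>x. (1 / s) * indicator {z..} x"
  have l0: "0 \<le> l" using s l by (meson order_trans zero_le_divide_1_iff less_imp_le)
  have \<phi>: "test_function ?\<phi>" using s by (intro test_functionI[of _ "1 / s"]) (auto simp: indicator_def)
  have \<phi>': "test_function (\<lambda>x. l * indicator {z..} x)" using l0 by (intro test_functionI[of _ l]) (auto simp: indicator_def)
  obtain W where W: "mild ?\<phi> W" using mild_ex[OF \<phi>] by blast
  have "W s x \<le> V s x"
    using s l by (intro mild_mono[OF \<phi> \<phi>' _ W V]) (auto simp: indicator_def)
  have "ennreal (measure gauss {a..} / s) = (\<integral>\<^sup>+w. ennreal (1 / s) * indicator {a..} w \<partial>gauss)"
    using s by (simp add: nn_integral_cmult_indicator gauss.emeasure_eq_measure ennreal_mult[symmetric])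
  also have "\<dots> \<le> heat s (\<lambda>y. ennreal (?\<phi> y)) x"
    unfolding heat_def
  proof (intro nn_integral_mono)
    fix w
    have "z \<le> x + sqrt s * w" if "a \<le> w"
    proof -
      have "a * sqrt s \<le> w * sqrt s" using that s by (intro mult_right_mono) auto
      with x show ?thesis by (simp only: mult.commute[of "sqrt s"])
    qed
    then show "ennreal (1 / s) * indicator {a..} w \<le> ennreal (1 / s * indicator {z..} (x + sqrt s * w))"
      by (auto simp: indicator_def)
  qed
  also have "\<dots> \<le> 2 * ennreal (W s x)"
    using s by (intro mild_half_heat_le[OF W]) (auto simp: indicator_def)
  also have "\<dots> = ennreal (2 * W s x)"
    by (simp add: ennreal_mult')
  finally have "measure gauss {a..} / s \<le> 2 * W s x"
    using mild_nonneg[OF W] by (subst (asm) ennreal_le_iff) auto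
  then show ?thesis using \<open>W s x \<le> V s x\<close> by (simp add: gauss_tail_def)
qed

end


subsection \<open>Mass near the right edge\<close>

text \<open>The points are rounded down to the lattice of mesh \<open>h\<close>, so that this becomes a countable sum
  of terms \<open>\<nu>(\<psi>) exp (- \<nu>(\<phi>))\<close> with fixed test functions, to which \<open>moment_step\<close> applies.\<close>

definition tail_functional :: "real measure \<Rightarrow> real \<Rightarrow> real \<Rightarrow> real \<Rightarrow> ennreal" where
  "tail_functional \<nu> h v l = (\<integral>\<^sup>+y. ennreal (exp (- (l * measure \<nu> {of_int \<lfloor>y / h\<rfloor> * h + v..}))) \<partial>\<nu>)"

lemma floor_measurable: "(\<lambda>y::real. \<lfloor>y / h\<rfloor>) \<in> borel \<rightarrow>\<^sub>M count_space UNIV"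
  by measurable

lemma tail_functional_eq_sum:
  assumes \<nu>: "\<nu> \<in> finite_borel_measures"
  shows "tail_functional \<nu> h v l =
    (\<integral>\<^sup>+i. ennreal (exp (- (l * measure \<nu> {of_int i * h + v..}))) * emeasure \<nu> {y. \<lfloor>y / h\<rfloor> = i} \<partial>count_space UNIV)"
proof -
  have [measurable_cong]: "sets \<nu> = sets borel" by (rule finite_borel_measuresD[OF \<nu>])
  show ?thesis
    unfolding tail_functional_def
    using nn_integral_compose_countable[of "\<lambda>y. \<lfloor>y / h\<rfloor>" \<nu> "\<lambda>i. ennreal (exp (- (l * measure \<nu> {of_int i * h + v..})))"]
    by (simp add: finite_borel_measuresD[OF \<nu>])
qed

lemma measurable_nn_integral_count_space:
  fixes f :: "'b :: countable \<Rightarrow> 'a \<Rightarrow> ennreal"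
  assumes "\<And>i. f i \<in> borel_measurable N"
  shows "(\<lambda>x. \<integral>\<^sup>+i. f i x \<partial>count_space UNIV) \<in> borel_measurable N"
proof -
  interpret sigma_finite_measure "count_space (UNIV :: 'b set)"
    by (rule sigma_finite_measure_count_space)
  have "(\<lambda>(i, x). f i x) \<in> borel_measurable (count_space UNIV \<Otimes>\<^sub>M N)"
    by (rule measurable_pair_measure_countable1) (use assms in auto)
  from measurable_compose[OF measurable_pair_swap' this]
  have "(\<lambda>(x, i). f i x) \<in> borel_measurable (N \<Otimes>\<^sub>M count_space UNIV)"
    by (simp add: case_prod_beta')
  then show ?thesis by (rule borel_measurable_nn_integral)
qed

lemma measurable_tail_functional: "(\<lambda>\<nu>. tail_functional \<nu> h v l) \<in> borel_measurable weak_borel"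
proof -
  note [measurable] = measurable_weak_borel_emeasure measurable_weak_borel_atLeast
  have "(\<lambda>\<nu>. \<integral>\<^sup>+i. ennreal (exp (- (l * measure \<nu> {of_int i * h + v..}))) * emeasure \<nu> {y. \<lfloor>y / h\<rfloor> = i} \<partial>count_space UNIV) \<in> borel_measurable weak_borel"
    by (rule measurable_nn_integral_count_space) measurable
  also have "?this \<longleftrightarrow> ?thesis"
    by (intro measurable_cong) (simp add: tail_functional_eq_sum space_weak_borel)
  finally show ?thesis .
qed

lemma tail_functional_le_mass:
  assumes "\<nu> \<in> finite_borel_measures" "0 \<le> l"
  shows "tail_functional \<nu> h v l \<le> emeasure \<nu> UNIV"
proof -
  have "tail_functional \<nu> h v l \<le> (\<integral>\<^sup>+y. 1 \<partial>\<nu>)"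
    unfolding tail_functional_def using assms(2) by (intro nn_integral_mono) auto
  then show ?thesis using finite_borel_measuresD[OF assms(1)] by simp
qed

text \<open>A discrete form of integrating \<open>exp (- (l * b))\<close> against the decrease of
  the tail mass \<open>b\<close>. In each cell the exponential is evaluated at the larger tail mass,
  since points are rounded down, so the sum lies below a telescoping one.\<close>

lemma tail_functional_zero_le:
  assumes \<nu>: "\<nu> \<in> finite_borel_measures" and h: "0 < h" and l: "0 < l"
  shows "tail_functional \<nu> h 0 l \<le> ennreal (1 / l) * ennreal (1 - exp (- (l * measure \<nu> UNIV)))"
proof -
  interpret finite_measure \<nu> by (rule finite_borel_measuresD[OF \<nu>])
  have sets [measurable_cong, simp]: "sets \<nu> = sets borel" and space [simp]: "space \<nu> = UNIV"
    using finite_borel_measuresD[OF \<nu>] by auto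
  define b where "b i = measure \<nu> {of_int i * h..}" for i :: int
  have b: "0 \<le> b i" "b i \<le> measure \<nu> UNIV" for i
    by (auto simp: b_def intro!: finite_measure_mono)
  have cell: "measure \<nu> {y. \<lfloor>y / h\<rfloor> = i} = b i - b (i + 1)" for i
  proof -
    have "{y. \<lfloor>y / h\<rfloor> = i} = {of_int i * h..} - {of_int (i + 1) * h..}"
      using h by (auto simp: floor_eq_iff field_simps)
    also have "measure \<nu> \<dots> = b i - b (i + 1)"
      using h unfolding b_def by (intro finite_measure_Diff) (auto intro: order_trans[rotated])
    finally show ?thesis .
  qed
  have cell_le: "exp (- (l * b i)) * measure \<nu> {y. \<lfloor>y / h\<rfloor> = i} \<le> (exp (- (l * b (i + 1))) - exp (- (l * b i))) / l" for i
  proof -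
    have "1 + l * (b i - b (i + 1)) \<le> exp (l * (b i - b (i + 1)))"
      by (rule exp_ge_add_one_self)
    then have "exp (- (l * b i)) * (1 + l * (b i - b (i + 1))) \<le> exp (- (l * b i)) * exp (l * (b i - b (i + 1)))"
      by (rule mult_left_mono) simp
    also have "\<dots> = exp (- (l * b (i + 1)))"
      by (simp add: exp_add[symmetric] algebra_simps)
    finally have "exp (- (l * b i)) * (b i - b (i + 1)) * l \<le> exp (- (l * b (i + 1))) - exp (- (l * b i))"
      by (simp add: algebra_simps)
    then show ?thesis using l by (simp add: cell pos_le_divide_eq)
  qed
  let ?f = "\<lambda>i. ennreal (exp (- (l * b i)) * measure \<nu> {y. \<lfloor>y / h\<rfloor> = i})"
  have fin: "(\<Sum>i\<in>{- int n..<int n}. exp (- (l * b i)) * measure \<nu> {y. \<lfloor>y / h\<rfloor> = i}) \<le> 1 / l * (1 - exp (- (l * measure \<nu> UNIV)))" for n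
  proof -
    have "(\<Sum>i\<in>{- int n..<int n}. exp (- (l * b i)) * measure \<nu> {y. \<lfloor>y / h\<rfloor> = i})
      \<le> (\<Sum>i\<in>{- int n..<int n}. (exp (- (l * b (i + 1))) - exp (- (l * b i))) / l)"
      by (intro sum_mono cell_le)
    \<comment> \<open>The shift \<open>i = k - n\<close> turns the symmetric window into an initial
      segment, on which the sum telescopes.\<close>
    also have "\<dots> = (\<Sum>k<2*n. (exp (- (l * b (int (Suc k) - int n))) - exp (- (l * b (int k - int n)))) / l)"
      by (rule sum.reindex_bij_witness[of _ "\<lambda>k. int k - int n" "\<lambda>i. nat (i + int n)"]) (auto simp: algebra_simps)
    also have "\<dots> = (\<Sum>k<2*n. exp (- (l * b (int (Suc k) - int n))) - exp (- (l * b (int k - int n)))) / l"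
      by (rule sum_divide_distrib[symmetric])
    also have "(\<Sum>k<2*n. exp (- (l * b (int (Suc k) - int n))) - exp (- (l * b (int k - int n))))
      = exp (- (l * b (int (2*n) - int n))) - exp (- (l * b (int 0 - int n)))"
      by (rule sum_lessThan_telescope)
    \<comment> \<open>The tail mass at the right end is at least \<open>0\<close>, and that at the
      left end at most the total mass.\<close>
    also have "\<dots> / l \<le> (1 - exp (- (l * measure \<nu> UNIV))) / l"
      using b l by (intro divide_right_mono diff_mono) auto
    finally show ?thesis by simp
  qed
  have "tail_functional \<nu> h 0 l = (\<integral>\<^sup>+i. ?f i \<partial>count_space UNIV)"
    by (simp add: tail_functional_eq_sum[OF \<nu>] emeasure_eq_measure b_def ennreal_mult)
  also have "\<dots> = (\<integral>\<^sup>+i. (SUP n. ?f i * indicator {- int n..<int n} i) \<partial>count_space UNIV)"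
  proof (intro nn_integral_cong)
    fix i
    have "?f i * indicator {- int (nat \<bar>i\<bar> + 1)..<int (nat \<bar>i\<bar> + 1)} i = ?f i" by (auto simp: indicator_def)
    then show "?f i = (SUP n. ?f i * indicator {- int n..<int n} i)"
      by (intro antisym SUP_least) (metis (no_types, lifting) SUP_upper UNIV_I, auto simp: indicator_def)
  qed
  also have "\<dots> = (SUP n. \<integral>\<^sup>+i. ?f i * indicator {- int n..<int n} i \<partial>count_space UNIV)"
    by (intro nn_integral_monotone_convergence_SUP) (auto simp: incseq_def le_fun_def indicator_def)
  also have "\<dots> \<le> ennreal (1 / l * (1 - exp (- (l * measure \<nu> UNIV))))"
  proof (rule SUP_least)
    fix n
    have "(\<integral>\<^sup>+i. ?f i * indicator {- int n..<int n} i \<partial>count_space UNIV) = (\<Sum>i\<in>{- int n..<int n}. ?f i)"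
      by (subst nn_integral_count_space'[of "{- int n..<int n}"]) (auto simp: indicator_def)
    also have "\<dots> = ennreal (\<Sum>i\<in>{- int n..<int n}. exp (- (l * b i)) * measure \<nu> {y. \<lfloor>y / h\<rfloor> = i})"
      by (rule sum_ennreal) simp
    also have "\<dots> \<le> ennreal (1 / l * (1 - exp (- (l * measure \<nu> UNIV))))"
      by (rule ennreal_leI[OF fin])
    finally show "(\<integral>\<^sup>+i. ?f i * indicator {- int n..<int n} i \<partial>count_space UNIV) \<le> ennreal (1 / l * (1 - exp (- (l * measure \<nu> UNIV))))" .
  qed
  also have "\<dots> = ennreal (1 / l) * ennreal (1 - exp (- (l * measure \<nu> UNIV)))"
    using l by (intro ennreal_mult) auto
  finally show ?thesis .
qed

text \<open>Displacements are rounded down to multiples of one standard deviation; those to the left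
  all count as \<open>0\<close>.\<close>

definition cell_step :: "real \<Rightarrow> nat" where
  "cell_step z = nat \<lfloor>z\<rfloor>"

lemma measurable_cell_step [measurable]: "cell_step \<in> borel \<rightarrow>\<^sub>M count_space UNIV"
  unfolding cell_step_def by measurable

text \<open>The number \<open>a n\<close> is free: it says how far to the left of the half-line, in standard deviations,
  the lower bound on the solution \<open>U i\<close> is used when the displacement falls in the \<open>n\<close>-th cell.\<close>

lemma cell_sum_le:
  fixes a :: "nat \<Rightarrow> real" and H :: "int \<Rightarrow> real \<Rightarrow> real" and U :: "int \<Rightarrow> real \<Rightarrow> real"
  assumes \<nu>: "\<nu> \<in> finite_borel_measures" and h: "0 < h" and s: "0 < s" and v: "v \<le> sqrt s"
    and H: "\<And>i. test_function (H i)" "\<And>i x. ennreal (H i x) = emeasure gauss {z. \<lfloor>(x + sqrt s * z) / h\<rfloor> = i}"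
    and U: "\<And>i. test_function (U i)" "\<And>i a x. of_int i * h + v - a * sqrt s \<le> x \<Longrightarrow> gauss_tail a / s \<le> U i x"
  shows "(\<integral>\<^sup>+i. ennreal ((LINT x|\<nu>. H i x) * exp (- (LINT x|\<nu>. U i x))) \<partial>count_space UNIV)
    \<le> (\<integral>\<^sup>+n. emeasure gauss {z. cell_step z = n} * tail_functional \<nu> (sqrt s) (sqrt s * (real n + 3 - a n)) (gauss_tail (a n) / s) \<partial>count_space UNIV)"
proof -
  interpret finite_measure \<nu> by (rule finite_borel_measuresD[OF \<nu>])
  have sets [measurable_cong, simp]: "sets \<nu> = sets borel" and space [simp]: "space \<nu> = UNIV"
    using finite_borel_measuresD[OF \<nu>] by auto
  have [measurable]: "H i \<in> borel_measurable borel" and H0: "0 \<le> H i x" for i x using H(1) by (auto simp: test_function_def)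
  let ?c = "\<lambda>i. exp (- (LINT x|\<nu>. U i x))"
  let ?g = "\<lambda>n j. ennreal (exp (- (gauss_tail (a n) / s * measure \<nu> {of_int j * sqrt s + sqrt s * (real n + 3 - a n)..})))"
  \<comment> \<open>The number 3 in the offset collects three units \<open>sqrt s\<close>: one for
    \<open>v \<le> sqrt s\<close>, one for rounding \<open>y\<close> down, and one for rounding
    \<open>z\<close> down. For negative \<open>z\<close>, which fall in cell \<open>0\<close>, the
    last holds with room to spare.\<close>
  have key: "ennreal (?c \<lfloor>(y + sqrt s * z) / h\<rfloor>) \<le> ?g (cell_step z) \<lfloor>y / sqrt s\<rfloor>" for y z
  proof -
    define i where "i = \<lfloor>(y + sqrt s * z) / h\<rfloor>"
    define j where "j = \<lfloor>y / sqrt s\<rfloor>"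
    define n where "n = cell_step z"
    let ?e = "of_int j * sqrt s + sqrt s * (real n + 3 - a n)"
    have "of_int i * h \<le> y + sqrt s * z"
      using h mult_right_mono[OF of_int_floor_le[of "(y + sqrt s * z) / h"], of h] by (simp add: i_def)
    moreover have "y \<le> (of_int j + 1) * sqrt s"
      using s mult_right_mono[OF real_of_int_floor_add_one_ge[of "y / sqrt s"], of "sqrt s"] by (simp add: j_def)
    moreover have "sqrt s * z \<le> sqrt s * (real n + 1)"
    proof (intro mult_left_mono)
      show "z \<le> real n + 1"
        using real_of_int_floor_add_one_ge[of z] by (simp add: n_def cell_step_def) linarith
    qed (use s in simp)
    ultimately have le: "of_int i * h + v - a n * sqrt s \<le> ?e"
      using v by (simp add: algebra_simps)
    have "gauss_tail (a n) / s * measure \<nu> {?e..} = (LINT x|\<nu>. gauss_tail (a n) / s * indicator {?e..} x)"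
      by simp
    also have "\<dots> \<le> (LINT x|\<nu>. U i x)"
    proof (rule integral_mono)
      show "integrable \<nu> (U i)" by (rule integrable_test_function[OF \<nu> U(1)])
    next
      fix x
      show "gauss_tail (a n) / s * indicator {?e..} x \<le> U i x"
        using U(2)[of i "a n" x] le U(1)[of i] by (auto simp: indicator_def test_function_def)
    next
      show "integrable \<nu> (\<lambda>x. gauss_tail (a n) / s * indicator {?e..} x)"
        by (rule integrable_finite_borel[OF \<nu>, where B = "\<bar>gauss_tail (a n) / s\<bar>"]) (auto simp: indicator_def)
    qed
    finally show ?thesis
      by (intro ennreal_leI) (simp add: i_def j_def n_def)
  qed
  have "(\<integral>\<^sup>+i. ennreal ((LINT x|\<nu>. H i x) * ?c i) \<partial>count_space UNIV)
    = (\<integral>\<^sup>+i. \<integral>\<^sup>+y. ennreal (?c i) * ennreal (H i y) \<partial>\<nu> \<partial>count_space UNIV)"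
  proof (intro nn_integral_cong)
    fix i
    have "(\<integral>\<^sup>+y. ennreal (?c i) * ennreal (H i y) \<partial>\<nu>) = ennreal (?c i) * (\<integral>\<^sup>+y. ennreal (H i y) \<partial>\<nu>)"
      by (rule nn_integral_cmult) measurable
    also have "(\<integral>\<^sup>+y. ennreal (H i y) \<partial>\<nu>) = ennreal (LINT x|\<nu>. H i x)"
      using H0 by (intro nn_integral_eq_integral integrable_test_function[OF \<nu> H(1)]) auto
    finally show "ennreal ((LINT x|\<nu>. H i x) * ?c i) = (\<integral>\<^sup>+y. ennreal (?c i) * ennreal (H i y) \<partial>\<nu>)"
      by (simp add: ennreal_mult'' mult.commute)
  qed
  also have "\<dots> = (\<integral>\<^sup>+y. \<integral>\<^sup>+i. ennreal (?c i) * ennreal (H i y) \<partial>count_space UNIV \<partial>\<nu>)"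
    by (rule nn_integral_count_space_nn_integral[symmetric]) auto
  \<comment> \<open>Since \<open>H i y\<close> is the probability that the displaced point falls in
    cell \<open>i\<close>, the sum over \<open>i\<close> is an average over displacements.\<close>
  also have "\<dots> = (\<integral>\<^sup>+y. \<integral>\<^sup>+z. ennreal (?c \<lfloor>(y + sqrt s * z) / h\<rfloor>) \<partial>gauss \<partial>\<nu>)"
  proof (intro nn_integral_cong)
    fix y
    show "(\<integral>\<^sup>+i. ennreal (?c i) * ennreal (H i y) \<partial>count_space UNIV) = (\<integral>\<^sup>+z. ennreal (?c \<lfloor>(y + sqrt s * z) / h\<rfloor>) \<partial>gauss)"
      using nn_integral_compose_countable[of "\<lambda>z. \<lfloor>(y + sqrt s * z) / h\<rfloor>" gauss "\<lambda>i. ennreal (?c i)"]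
      by (simp add: H(2))
  qed
  also have "\<dots> \<le> (\<integral>\<^sup>+y. \<integral>\<^sup>+z. ?g (cell_step z) \<lfloor>y / sqrt s\<rfloor> \<partial>gauss \<partial>\<nu>)"
    by (intro nn_integral_mono key)
  also have "\<dots> = (\<integral>\<^sup>+y. \<integral>\<^sup>+n. ?g n \<lfloor>y / sqrt s\<rfloor> * emeasure gauss {z. cell_step z = n} \<partial>count_space UNIV \<partial>\<nu>)"
  proof (intro nn_integral_cong)
    fix y
    show "(\<integral>\<^sup>+z. ?g (cell_step z) \<lfloor>y / sqrt s\<rfloor> \<partial>gauss) = (\<integral>\<^sup>+n. ?g n \<lfloor>y / sqrt s\<rfloor> * emeasure gauss {z. cell_step z = n} \<partial>count_space UNIV)"
      using nn_integral_compose_countable[of cell_step gauss "\<lambda>n. ?g n \<lfloor>y / sqrt s\<rfloor>"] by simp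
  qed
  also have "\<dots> = (\<integral>\<^sup>+n. \<integral>\<^sup>+y. ?g n \<lfloor>y / sqrt s\<rfloor> * emeasure gauss {z. cell_step z = n} \<partial>\<nu> \<partial>count_space UNIV)"
    by (rule nn_integral_count_space_nn_integral) (auto intro!: measurable_compose[OF floor_measurable])
  also have "\<dots> = (\<integral>\<^sup>+n. emeasure gauss {z. cell_step z = n} * tail_functional \<nu> (sqrt s) (sqrt s * (real n + 3 - a n)) (gauss_tail (a n) / s) \<partial>count_space UNIV)"
  proof (intro nn_integral_cong)
    fix n
    have "(\<lambda>y. ?g n \<lfloor>y / sqrt s\<rfloor>) \<in> borel_measurable \<nu>"
      using measurable_compose[OF floor_measurable[of "sqrt s"], of "?g n" borel] by (simp cong: measurable_cong_sets)
    then show "(\<integral>\<^sup>+y. ?g n \<lfloor>y / sqrt s\<rfloor> * emeasure gauss {z. cell_step z = n} \<partial>\<nu>) =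
      emeasure gauss {z. cell_step z = n} * tail_functional \<nu> (sqrt s) (sqrt s * (real n + 3 - a n)) (gauss_tail (a n) / s)"
      by (subst nn_integral_multc) (simp_all add: tail_functional_def mult.commute)
  qed
  finally show ?thesis .
qed

section \<open>Moments of the rounded displacement\<close>

lemma gauss_fourth_moment: "(\<integral>\<^sup>+z. ennreal (z ^ 4) \<partial>gauss) = 3"
proof -
  have "(\<integral>\<^sup>+z. ennreal (z ^ 4) \<partial>gauss) = (\<integral>\<^sup>+z. ennreal (std_normal_density z * z ^ 4) \<partial>lborel)"
    unfolding gauss_def by (subst nn_integral_density) (auto simp: ennreal_mult)
  also have "\<dots> = ennreal (fact (2 * 2) / (2 ^ 2 * fact 2))"
    using std_normal_moment_even[of 2] by (intro nn_integral_eq_integral[THEN trans])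
      (auto simp: has_bochner_integral_iff)
  also have "fact (2 * 2) / (2 ^ 2 * fact 2) = (3 :: real)"
    by (simp add: fact_numeral)
  finally show ?thesis by simp
qed

text \<open>Where the rounded displacement \<open>n\<close> is at least \<open>A\<close>, also
  \<open>z \<ge> A\<close>, so \<open>(n + 1)\<^sup>2\<close> is at most
  \<open>(2 * z)\<^sup>2\<close> and hence at most \<open>4 / A\<^sup>2\<close> times
  \<open>z ^ 4\<close>. The fourth moment \<open>3\<close> gives the constant
  \<open>12\<close>.\<close>

lemma cell_step_tail_moment_le:
  assumes A: "1 \<le> A"
  shows "(\<integral>\<^sup>+n. emeasure gauss {z. cell_step z = n} * (ennreal ((real n + 1)\<^sup>2) * indicator {A..} n) \<partial>count_space UNIV) \<le> ennreal (12 / (real A)\<^sup>2)"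
proof -
  have "(\<integral>\<^sup>+n. emeasure gauss {z. cell_step z = n} * (ennreal ((real n + 1)\<^sup>2) * indicator {A..} n) \<partial>count_space UNIV)
    = (\<integral>\<^sup>+z. ennreal ((real (cell_step z) + 1)\<^sup>2) * indicator {A..} (cell_step z) \<partial>gauss)"
    using nn_integral_compose_countable[of cell_step gauss "\<lambda>n. ennreal ((real n + 1)\<^sup>2) * indicator {A..} n"]
    by (simp add: mult.commute)
  also have "\<dots> \<le> (\<integral>\<^sup>+z. ennreal (4 / (real A)\<^sup>2) * ennreal (z ^ 4) \<partial>gauss)"
  proof (intro nn_integral_mono)
    fix z
    have "(real (cell_step z) + 1)\<^sup>2 \<le> 4 / (real A)\<^sup>2 * z ^ 4" if *: "A \<le> cell_step z"
    proof -
      have z: "real (cell_step z) \<le> z" using * A by (simp add: cell_step_def) linarith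
      have Az: "real A \<le> z" using z * by linarith
      have "(real (cell_step z) + 1)\<^sup>2 \<le> (2 * z)\<^sup>2"
        using z Az A by (intro power_mono) auto
      also have "\<dots> \<le> 4 / (real A)\<^sup>2 * z ^ 4"
      proof -
        have "z\<^sup>2 * (real A)\<^sup>2 \<le> z\<^sup>2 * z\<^sup>2"
          using Az by (intro mult_left_mono power_mono) auto
        then show ?thesis using A by (simp add: field_simps power4_eq_xxxx power2_eq_square)
      qed
      finally show ?thesis .
    qed
    then show "ennreal ((real (cell_step z) + 1)\<^sup>2) * indicator {A..} (cell_step z) \<le> ennreal (4 / (real A)\<^sup>2) * ennreal (z ^ 4)"
      by (auto simp: indicator_def ennreal_mult[symmetric] intro!: ennreal_leI)
  qed
  also have "\<dots> = ennreal (4 / (real A)\<^sup>2) * ennreal 3"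
    by (subst nn_integral_cmult) (auto simp: gauss_fourth_moment)
  also have "\<dots> = ennreal (12 / (real A)\<^sup>2)"
    by (subst ennreal_mult[symmetric]) auto
  finally show ?thesis .
qed

section \<open>Recursion for the mean of the tail functional\<close>

context superprocess_marginals
begin

text \<open>This is \<open>D t v l\<close> of the opening outline, for the lattice of mesh
  \<open>h\<close>. The mesh is a parameter because a step back in time replaces it by
  \<open>sqrt s\<close>.\<close>

definition edge_mean :: "real \<Rightarrow> real \<Rightarrow> real \<Rightarrow> real \<Rightarrow> ennreal" where
  "edge_mean t h v l = (\<integral>\<^sup>+\<omega>. tail_functional (Y t \<omega>) h v l \<partial>M)"

lemma measurable_Y_tail_functional: "0 < t \<Longrightarrow> (\<lambda>\<omega>. tail_functional (Y t \<omega>) h v l) \<in> borel_measurable M"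
  by (rule measurable_compose[OF measurable_Y measurable_tail_functional])

text \<open>\<open>moment_step\<close> is applied to each lattice cell, with the cell indicator as
  \<open>\<psi>\<close> and the half-line function as \<open>\<phi>\<close>;
  \<open>cell_sum_le\<close> then sums over displacements. The choice of \<open>a\<close> is left
  open for \<open>edge_mean_improve\<close>.\<close>

lemma edge_mean_step:
  assumes r: "0 < r" and s: "0 < s" and h: "0 < h" and v: "v \<le> sqrt s" and l: "1 / s \<le> l"
  shows "edge_mean (r + s) h v l \<le> (\<integral>\<^sup>+n. emeasure gauss {z. cell_step z = n} *
    edge_mean r (sqrt s) (sqrt s * (real n + 3 - a n)) (gauss_tail (a n) / s) \<partial>count_space UNIV)"
proof -
  have t: "0 < r + s" using r s by simp
  have l0: "0 \<le> l" using s l by (meson order_trans zero_le_divide_1_iff less_imp_le)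
  define \<phi> where "\<phi> i x = l * indicator {of_int i * h + v..} x" for i x
  define \<psi> :: "int \<Rightarrow> real \<Rightarrow> real" where "\<psi> i = indicator {y. \<lfloor>y / h\<rfloor> = i}" for i
  define H where "H i x = measure gauss {z. \<lfloor>(x + sqrt s * z) / h\<rfloor> = i}" for i x
  have \<phi>: "test_function (\<phi> i)" for i
    unfolding \<phi>_def using l0 by (intro test_functionI[of _ l]) (auto simp: indicator_def)
  have \<psi>: "test_function (\<psi> i)" for i
    unfolding \<psi>_def by (intro test_functionI[of _ 1]) (auto simp: indicator_def)
  have H_heat: "ennreal (H i x) = heat s (\<lambda>y. ennreal (\<psi> i y)) x" for i x
  proof -
    have "heat s (\<lambda>y. ennreal (\<psi> i y)) x = (\<integral>\<^sup>+z. indicator {z. \<lfloor>(x + sqrt s * z) / h\<rfloor> = i} z \<partial>gauss)"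
      unfolding heat_def \<psi>_def by (intro nn_integral_cong) (simp add: indicator_def)
    also have "\<dots> = emeasure gauss {z. \<lfloor>(x + sqrt s * z) / h\<rfloor> = i}"
      by (rule nn_integral_indicator) measurable
    finally show ?thesis by (simp add: H_def gauss.emeasure_eq_measure)
  qed
  have H: "test_function (H i)" for i
  proof (rule test_functionI[of _ 1])
    have [measurable]: "\<psi> i \<in> borel_measurable borel" using \<psi> by (simp add: test_function_def)
    have "(\<lambda>x. enn2real (heat s (\<lambda>y. ennreal (\<psi> i y)) x)) \<in> borel_measurable borel" by measurable
    also have "(\<lambda>x. enn2real (heat s (\<lambda>y. ennreal (\<psi> i y)) x)) = H i"
      by (simp add: H_heat[symmetric] fun_eq_iff H_def)
    finally show "H i \<in> borel_measurable borel" .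
  qed (auto simp: H_def)
  have "\<exists>V. \<forall>i. mild (\<phi> i) (V i)" using mild_ex[OF \<phi>] by (intro choice) blast
  then obtain V where V: "\<And>i. mild (\<phi> i) (V i)" by blast
  have U: "test_function (V i s)" for i
    using s by (intro test_function_mild[OF \<phi> V]) simp
  have U_ge: "gauss_tail a / s \<le> V i s x" if "of_int i * h + v - a * sqrt s \<le> x" for i a x
    using V[of i] unfolding \<phi>_def by (rule mild_halfline_ge[OF _ s l that])
  have tf: "tail_functional (Y (r + s) \<omega>) h v l = (\<integral>\<^sup>+i. ennreal ((LINT x|Y (r + s) \<omega>. \<psi> i x) * exp (- (LINT x|Y (r + s) \<omega>. \<phi> i x))) \<partial>count_space UNIV)"
    if "\<omega> \<in> space M" for \<omega>
  proof -
    note fin = Y_finite[OF t that]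
    interpret finite_measure "Y (r + s) \<omega>" by (rule finite_borel_measuresD[OF fin])
    show ?thesis
      unfolding tail_functional_eq_sum[OF fin] \<phi>_def \<psi>_def
      using finite_borel_measuresD(2,3)[OF fin]
      by (intro nn_integral_cong) (simp add: emeasure_eq_measure ennreal_mult mult.commute)
  qed
  note [measurable] = measurable_Y_integral[OF t \<phi>] measurable_Y_integral[OF t \<psi>]
    measurable_Y_integral[OF r H] measurable_Y_integral[OF r U] measurable_Y_tail_functional[OF r]
  have "edge_mean (r + s) h v l =
    (\<integral>\<^sup>+\<omega>. \<integral>\<^sup>+i. ennreal ((LINT x|Y (r + s) \<omega>. \<psi> i x) * exp (- (LINT x|Y (r + s) \<omega>. \<phi> i x))) \<partial>count_space UNIV \<partial>M)"
    unfolding edge_mean_def by (intro nn_integral_cong tf)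
  also have "\<dots> = (\<integral>\<^sup>+i. \<integral>\<^sup>+\<omega>. ennreal ((LINT x|Y (r + s) \<omega>. \<psi> i x) * exp (- (LINT x|Y (r + s) \<omega>. \<phi> i x))) \<partial>M \<partial>count_space UNIV)"
    by (rule nn_integral_count_space_nn_integral) auto
  also have "\<dots> \<le> (\<integral>\<^sup>+i. \<integral>\<^sup>+\<omega>. ennreal ((LINT x|Y r \<omega>. H i x) * exp (- (LINT x|Y r \<omega>. V i s x))) \<partial>M \<partial>count_space UNIV)"
    using s by (intro nn_integral_mono moment_step[OF \<phi> \<psi> V r _ H H_heat]) auto
  also have "\<dots> = (\<integral>\<^sup>+\<omega>. \<integral>\<^sup>+i. ennreal ((LINT x|Y r \<omega>. H i x) * exp (- (LINT x|Y r \<omega>. V i s x))) \<partial>count_space UNIV \<partial>M)"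
    by (rule nn_integral_count_space_nn_integral[symmetric]) auto
  also have "\<dots> \<le> (\<integral>\<^sup>+\<omega>. \<integral>\<^sup>+n. emeasure gauss {z. cell_step z = n} *
      tail_functional (Y r \<omega>) (sqrt s) (sqrt s * (real n + 3 - a n)) (gauss_tail (a n) / s) \<partial>count_space UNIV \<partial>M)"
    by (intro nn_integral_mono cell_sum_le[OF Y_finite[OF r] h s v H _ U U_ge])
       (auto simp: H_def gauss.emeasure_eq_measure)
  also have "\<dots> = (\<integral>\<^sup>+n. \<integral>\<^sup>+\<omega>. emeasure gauss {z. cell_step z = n} *
      tail_functional (Y r \<omega>) (sqrt s) (sqrt s * (real n + 3 - a n)) (gauss_tail (a n) / s) \<partial>M \<partial>count_space UNIV)"
    by (rule nn_integral_count_space_nn_integral) auto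
  also have "\<dots> = (\<integral>\<^sup>+n. emeasure gauss {z. cell_step z = n} *
    edge_mean r (sqrt s) (sqrt s * (real n + 3 - a n)) (gauss_tail (a n) / s) \<partial>count_space UNIV)"
    unfolding edge_mean_def by (intro nn_integral_cong nn_integral_cmult) measurable
  finally show ?thesis .
qed

text \<open>The exponential is at most \<open>1\<close>. This crude bound starts the iteration and
  covers short times.\<close>

lemma edge_mean_le_mass:
  assumes "0 < t" "0 \<le> l"
  shows "edge_mean t h v l \<le> ennreal m"
proof -
  have "edge_mean t h v l \<le> (\<integral>\<^sup>+\<omega>. emeasure (Y t \<omega>) UNIV \<partial>M)"
    unfolding edge_mean_def using assms by (intro nn_integral_mono tail_functional_le_mass Y_finite)
  also have "\<dots> \<le> ennreal m" by (rule first_moment_le[OF assms(1)])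
  finally show ?thesis .
qed

lemma edge_mean_zero_le:
  assumes t: "0 < t" and h: "0 < h" and l: "0 < l"
  shows "edge_mean t h 0 l \<le> ennreal (2 * m / (l * t))"
proof -
  have one: "test_function (\<lambda>_. 1)" by (rule test_functionI) auto
  have "(\<lambda>\<omega>. measure (Y t \<omega>) UNIV) \<in> borel_measurable M"
    by (rule measurable_cong[THEN iffD1, OF _ measurable_Y_integral[OF t one]])
       (simp add: finite_borel_measuresD(3)[OF Y_finite[OF t]])
  note [measurable] = this
  have "edge_mean t h 0 l \<le> (\<integral>\<^sup>+\<omega>. ennreal (1 / l) * ennreal (1 - exp (- (l * measure (Y t \<omega>) UNIV))) \<partial>M)"
    unfolding edge_mean_def by (intro nn_integral_mono tail_functional_zero_le Y_finite t h l)
  also have "\<dots> = ennreal (1 / l) * (\<integral>\<^sup>+\<omega>. ennreal (1 - exp (- (l * measure (Y t \<omega>) UNIV))) \<partial>M)"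
    by (rule nn_integral_cmult) measurable
  also have "\<dots> \<le> ennreal (1 / l) * ennreal (2 * m / t)"
    by (intro mult_left_mono extinction_le t l) simp
  also have "\<dots> = ennreal (2 * m / (l * t))"
    using l t m_nonneg by (subst ennreal_mult[symmetric]) auto
  finally show ?thesis .
qed

text \<open>One round of the recursion turns \<open>b\<close> into \<open>4 / k + b / 2\<close> with
  \<open>k = gauss_tail (real A + 2)\<close>: small displacements give the first term by the case of
  offset \<open>0\<close>, large ones at most \<open>b / 2\<close> by the choice of
  \<open>A\<close>. The variable \<open>s\<close> is kept separate from \<open>v\<close> and
  \<open>l\<close> because the hypothesis \<open>IH\<close> is used at a larger value of it.\<close>

lemma edge_mean_improve:
  assumes A: "1 \<le> A" "48 \<le> gauss_tail 2 * (real A)\<^sup>2" and b: "0 \<le> b"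
    and IH: "\<And>t h v l s. 0 < t \<Longrightarrow> t \<le> T \<Longrightarrow> 0 < h \<Longrightarrow> 0 \<le> v \<Longrightarrow> 0 < l \<Longrightarrow> s0 \<le> s \<Longrightarrow> v\<^sup>2 \<le> s \<Longrightarrow> 1 / l \<le> s \<Longrightarrow>
      edge_mean t h v l \<le> ennreal (b * m * s / t)"
    and t: "0 < t" "t \<le> T" and h: "0 < h" and v: "0 \<le> v" "v\<^sup>2 \<le> s" and l: "0 < l" "1 / l \<le> s" and s: "0 < s0" "s0 \<le> s"
  shows "edge_mean t h v l \<le> ennreal ((4 / gauss_tail (real A + 2) + b / 2) * m * s / t)"
\<comment> \<open>When \<open>t \<le> 2 * s\<close> the claim is weaker than the bound by
  \<open>m\<close>, because \<open>4 / k \<ge> 8\<close>. Otherwise the time left after the step is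
  at least \<open>t / 2\<close>.\<close>
proof (cases "t \<le> 2 * s")
  case True
  define k where "k = gauss_tail (real A + 2)"
  have k: "0 < k" "k \<le> 1 / 2" unfolding k_def by (rule gauss_tail_pos gauss_tail_le)+
  have s_pos: "0 < s" using s by simp
  have "1 \<le> 2 * s / t" using True t by (simp add: pos_le_divide_eq)
  also have "\<dots> \<le> (4 / k + b / 2) * s / t"
    using k b t s_pos by (intro divide_right_mono mult_right_mono) (auto simp: pos_le_divide_eq intro: add_increasing2)
  finally have "m * 1 \<le> m * ((4 / k + b / 2) * s / t)"
    by (rule mult_left_mono) (rule m_nonneg)
  then have "ennreal m \<le> ennreal ((4 / k + b / 2) * m * s / t)"
    by (intro ennreal_leI) (simp add: ac_simps)
  with edge_mean_le_mass[of t l h v] t l show ?thesis by (simp add: k_def)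
next
  case False
  define r where "r = t - s"
  have s_pos: "0 < s" using s by simp
  have r: "0 < r" "t / 2 \<le> r" "r \<le> T" and t_eq: "t = r + s" using False s_pos t by (auto simp: r_def)
  define k where "k = gauss_tail (real A + 2)"
  define k2 where "k2 = gauss_tail 2"
  have k: "0 < k" and k2: "0 < k2" "k2 \<le> 1 / 2" unfolding k_def k2_def by (rule gauss_tail_pos gauss_tail_le)+
  \<comment> \<open>Below \<open>A\<close>, the value \<open>n + 3\<close> makes the new offset
    \<open>0\<close>; from \<open>A\<close> on, the value \<open>2\<close> leaves the offset
    \<open>n + 1\<close> and a Gaussian tail that does not depend on \<open>n\<close>.\<close>
  define a where "a n = (if n < A then real n + 3 else 2)" for n
  define q where "q n = emeasure gauss {z. cell_step z = n}" for n
  let ?F = "\<lambda>n. edge_mean r (sqrt s) (sqrt s * (real n + 3 - a n)) (gauss_tail (a n) / s)"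
  let ?c1 = "4 * m * s / (k * t)" and ?c2 = "2 * b * m * s / (k2 * t)"
  have c: "0 \<le> ?c1" "0 \<le> ?c2" using k k2 b m_nonneg s_pos t by auto
  have r_inv: "1 / r \<le> 2 / t" using r t by (simp add: field_simps)
  have F: "?F n \<le> ennreal ?c1 + ennreal ?c2 * (ennreal ((real n + 1)\<^sup>2) * indicator {A..} n)" for n
  proof (cases "n < A")
    case True
    \<comment> \<open>Here \<open>n + 3 \<le> A + 2\<close>, so the one constant \<open>k\<close>
      serves all cells below \<open>A\<close>.\<close>
    have g: "k \<le> gauss_tail (real n + 3)"
      unfolding k_def using True by (intro gauss_tail_antimono) simp
    have "?F n \<le> ennreal (2 * m / (gauss_tail (real n + 3) / s * r))"
      using True edge_mean_zero_le[of r "sqrt s" "gauss_tail (real n + 3) / s"] r s_pos gauss_tail_pos[of "real n + 3"]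
      by (simp add: a_def)
    also have "\<dots> \<le> ennreal ?c1"
    proof (intro ennreal_leI)
      have "2 * m / (gauss_tail (real n + 3) / s * r) = 2 * m * s * (1 / gauss_tail (real n + 3)) * (1 / r)"
        using s_pos by simp
      also have "\<dots> \<le> 2 * m * s * (1 / k) * (2 / t)"
      proof (intro mult_mono mult_left_mono r_inv)
        show "1 / gauss_tail (real n + 3) \<le> 1 / k" using g k by (intro frac_le) auto
      qed (use k m_nonneg s_pos r less_imp_le[OF gauss_tail_pos] in auto)
      also have "\<dots> = ?c1" by simp
      finally show "2 * m / (gauss_tail (real n + 3) / s * r) \<le> ?c1" .
    qed
    finally show ?thesis by (simp add: add_increasing2)
  next
    case False
    \<comment> \<open>This value dominates the square of the new offset because
      \<open>k2 \<le> 1\<close>, and the inverse of the new coefficient \<open>k2 / s\<close>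
      because \<open>(n + 1)\<^sup>2 \<ge> 1\<close>; it also stays above \<open>s0\<close>.\<close>
    let ?s = "s * (real n + 1)\<^sup>2 / k2"
    have n1: "1 \<le> (real n + 1)\<^sup>2" by (simp add: one_le_power)
    have k2': "1 \<le> 1 / k2" using k2 by simp
    have s1: "s * (real n + 1)\<^sup>2 \<le> ?s"
      using mult_left_mono[OF k2', of "s * (real n + 1)\<^sup>2"] s_pos by simp
    have s2: "s / k2 \<le> ?s"
      using n1 s_pos k2 by (intro divide_right_mono) auto
    have s3: "s \<le> s * (real n + 1)\<^sup>2" using n1 s_pos by simp
    have "?F n = edge_mean r (sqrt s) (sqrt s * (real n + 1)) (k2 / s)"
      using False by (simp add: a_def k2_def add_ac)
    also have "\<dots> \<le> ennreal (b * m * ?s / r)"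
    proof (rule IH)
      show "(sqrt s * (real n + 1))\<^sup>2 \<le> ?s" using s1 s_pos by (simp add: power_mult_distrib)
      show "1 / (k2 / s) \<le> ?s" using s2 by simp
      show "s0 \<le> ?s" using s s1 s3 by linarith
    qed (use r s_pos k2 in auto)
    also have "\<dots> \<le> ennreal (?c2 * (real n + 1)\<^sup>2)"
    proof (intro ennreal_leI)
      have "b * m * ?s / r = b * m * ?s * (1 / r)" by simp
      also have "\<dots> \<le> b * m * ?s * (2 / t)"
        using b m_nonneg s_pos k2 by (intro mult_left_mono r_inv) auto
      also have "\<dots> = ?c2 * (real n + 1)\<^sup>2" by simp
      finally show "b * m * ?s / r \<le> ?c2 * (real n + 1)\<^sup>2" .
    qed
    also have "\<dots> = ennreal ?c2 * (ennreal ((real n + 1)\<^sup>2) * indicator {A..} n)"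
      using False by (subst ennreal_mult[OF c(2) zero_le_power2]) simp
    finally show ?thesis by (simp add: add_increasing)
  qed
  have q1: "(\<integral>\<^sup>+n. q n \<partial>count_space UNIV) = 1"
    using nn_integral_compose_countable[of cell_step gauss "\<lambda>_. 1"] by (simp add: q_def)
  have "edge_mean t h v l \<le> (\<integral>\<^sup>+n. q n * ?F n \<partial>count_space UNIV)"
    unfolding t_eq q_def using r s_pos h l v
    by (intro edge_mean_step) (auto simp: real_le_rsqrt field_simps)
  also have "\<dots> \<le> (\<integral>\<^sup>+n. ennreal ?c1 * q n + ennreal ?c2 * (q n * (ennreal ((real n + 1)\<^sup>2) * indicator {A..} n)) \<partial>count_space UNIV)"
    by (intro nn_integral_mono order_trans[OF mult_left_mono[OF F]]) (auto simp: distrib_left ac_simps)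
  also have "\<dots> = ennreal ?c1 + ennreal ?c2 * (\<integral>\<^sup>+n. q n * (ennreal ((real n + 1)\<^sup>2) * indicator {A..} n) \<partial>count_space UNIV)"
    by (simp add: nn_integral_add nn_integral_cmult q1)
  also have "\<dots> \<le> ennreal ?c1 + ennreal ?c2 * ennreal (12 / (real A)\<^sup>2)"
    unfolding q_def by (intro add_left_mono mult_left_mono cell_step_tail_moment_le A) simp
  also have "\<dots> = ennreal (?c1 + ?c2 * (12 / (real A)\<^sup>2))"
  proof -
    have d: "0 \<le> 12 / (real A)\<^sup>2" by simp
    show ?thesis
      unfolding ennreal_mult[OF c(2) d, symmetric] by (rule ennreal_plus[OF c(1) mult_nonneg_nonneg[OF c(2) d], symmetric])
  qed
  also have "\<dots> \<le> ennreal ((4 / k + b / 2) * m * s / t)"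
  proof (intro ennreal_leI)
    \<comment> \<open>The moment bound leaves the factor \<open>24 / (k2 * A\<^sup>2)\<close>, which
      is at most \<open>1 / 2\<close> by the second hypothesis on \<open>A\<close>.\<close>
    have "?c2 * (12 / (real A)\<^sup>2) = b * m * s / t * (24 / (k2 * (real A)\<^sup>2))"
      by (simp add: ac_simps)
    also have "\<dots> \<le> b * m * s / t * (1 / 2)"
      using A b m_nonneg s_pos t k2
      by (intro mult_left_mono) (auto simp: k2_def[symmetric] pos_divide_le_eq)
    finally show "?c1 + ?c2 * (12 / (real A)\<^sup>2) \<le> (4 / k + b / 2) * m * s / t"
      by (simp add: algebra_simps add_divide_distrib)
  qed
  finally show ?thesis by (simp add: k_def)
qed

text \<open>The map from \<open>b\<close> to \<open>4 / k + b / 2\<close> has the fixed point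
  \<open>8 / k\<close>. The distance to it halves in each round, so the limit is free of the
  starting value.\<close>

lemma edge_mean_le:
  assumes A: "1 \<le> A" "48 \<le> gauss_tail 2 * (real A)\<^sup>2"
    and t: "0 < t" and h: "0 < h" and v: "0 \<le> v" "v\<^sup>2 \<le> s" and l: "0 < l" "1 / l \<le> s"
  shows "edge_mean t h v l \<le> ennreal (8 / gauss_tail (real A + 2) * m * s / t)"
proof -
  \<comment> \<open>The given values are frozen, while \<open>t\<close>, \<open>h\<close>,
    \<open>v\<close>, \<open>l\<close> and \<open>s\<close> vary through the induction. The horizon
    \<open>T\<close> and the floor \<open>s0\<close> keep \<open>t / s\<close> below
    \<open>T / s0\<close>, which makes a finite starting constant possible.\<close>
  define T s0 where "T = t" and "s0 = s"
  have s_pos: "0 < s" using l by (meson less_le_trans zero_less_divide_1_iff)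
  then have s0: "0 < s0" and T: "0 < T" using t by (simp_all add: s0_def T_def)
  define k where "k = gauss_tail (real A + 2)"
  have k: "0 < k" unfolding k_def by (rule gauss_tail_pos)
  have bound: "edge_mean t h v l \<le> ennreal ((8 / k + T / s0 / 2 ^ n) * m * s / t)"
    if "0 < t" "t \<le> T" "0 < h" "0 \<le> v" "0 < l" "s0 \<le> s" "v\<^sup>2 \<le> s" "1 / l \<le> s" for n t h v l s
    using that
  proof (induction n arbitrary: t h v l s)
    case 0
    have "s0 * t \<le> s * T" using 0 s0 by (intro mult_mono) auto
    then have "1 \<le> T / s0 * s / t" using 0 s0 by (simp add: pos_le_divide_eq mult.commute)
    also have "\<dots> \<le> (8 / k + T / s0) * s / t"
      using 0 s0 k by (intro divide_right_mono mult_right_mono) auto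
    finally have "m * 1 \<le> m * ((8 / k + T / s0) * s / t)"
      by (rule mult_left_mono) (rule m_nonneg)
    then have "ennreal m \<le> ennreal ((8 / k + T / s0 / 2 ^ 0) * m * s / t)"
      by (intro ennreal_leI) (simp add: ac_simps)
    moreover have "edge_mean t h v l \<le> ennreal m" using 0 by (intro edge_mean_le_mass) auto
    ultimately show ?case by (rule order_trans[rotated])
  next
    case (Suc n)
    have "edge_mean t h v l \<le> ennreal ((4 / k + (8 / k + T / s0 / 2 ^ n) / 2) * m * s / t)"
      unfolding k_def
      by (rule edge_mean_improve[where T = T and ?s0.0 = s0, OF A _ Suc.IH[unfolded k_def]])
         (use Suc.prems k s0 T in \<open>auto simp: k_def\<close>)
    also have "4 / k + (8 / k + T / s0 / 2 ^ n) / 2 = 8 / k + T / s0 / 2 ^ Suc n"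
      by (simp add: add_divide_distrib)
    finally show ?case .
  qed
  have "(\<lambda>n. T / s0 * (1 / 2) ^ n) \<longlonglongrightarrow> T / s0 * 0"
    by (intro tendsto_mult tendsto_const LIMSEQ_power_zero) simp
  then have "(\<lambda>n. (8 / k + T / s0 * (1 / 2) ^ n) * m * s / t) \<longlonglongrightarrow> (8 / k + T / s0 * 0) * m * s / t"
    using t by (intro tendsto_intros) auto
  then have "(\<lambda>n. ennreal ((8 / k + T / s0 / 2 ^ n) * m * s / t)) \<longlonglongrightarrow> ennreal (8 / k * m * s / t)"
    by (intro tendsto_ennrealI) (simp add: power_divide)
  then show ?thesis
    unfolding k_def[symmetric] using bound[of t h v l s] t h v l
    by (intro LIMSEQ_le_const) (auto simp: T_def s0_def)
qed

text \<open>Offset \<open>2 * u\<close> and coefficient \<open>1 / \<epsilon>\<close> require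
  \<open>s\<close> to dominate \<open>4 * u\<^sup>2\<close> and \<open>\<epsilon>\<close>, whence
  \<open>s = 4 * max (u\<^sup>2) \<epsilon>\<close> and the constant
  \<open>32 = 8 * 4\<close>.\<close>

lemma edge_mass_bound:
  assumes A: "1 \<le> A" "48 \<le> gauss_tail 2 * (real A)\<^sup>2"
    and t: "0 < t" and \<epsilon>: "0 < \<epsilon>" and u: "0 < u"
    and f: "AE \<omega> in M. f \<omega> \<le> ennreal (exp 1) * tail_functional (Y t \<omega>) u (2 * u) (1 / \<epsilon>)"
  shows "(\<integral>\<^sup>+\<omega>. f \<omega> \<partial>M) \<le> ennreal (32 * exp 1 / gauss_tail (real A + 2) / t * m * max (u\<^sup>2) \<epsilon>)"
proof -
  let ?s = "4 * max (u\<^sup>2) \<epsilon>"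
  have "(\<integral>\<^sup>+\<omega>. f \<omega> \<partial>M) \<le> (\<integral>\<^sup>+\<omega>. ennreal (exp 1) * tail_functional (Y t \<omega>) u (2 * u) (1 / \<epsilon>) \<partial>M)"
    using f by (rule nn_integral_mono_AE)
  also have "\<dots> = ennreal (exp 1) * edge_mean t u (2 * u) (1 / \<epsilon>)"
    unfolding edge_mean_def by (rule nn_integral_cmult[OF measurable_Y_tail_functional[OF t]])
  also have "\<dots> \<le> ennreal (exp 1) * ennreal (8 / gauss_tail (real A + 2) * m * ?s / t)"
    using \<epsilon> u by (intro mult_left_mono edge_mean_le[OF A t]) (auto simp: max_def power_mult_distrib)
  also have "\<dots> = ennreal (32 * exp 1 / gauss_tail (real A + 2) / t * m * max (u\<^sup>2) \<epsilon>)"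
    by (subst ennreal_mult'[symmetric]) (simp_all add: ac_simps)
  finally show ?thesis .
qed

end

section \<open>From the mass near the edge to the tail functional\<close>

text \<open>For a point within \<open>u\<close> to the left of the edge, or beyond it, the half-line
  starting \<open>2 * u\<close> to the right of its lattice point has mass below
  \<open>\<epsilon>\<close>. The exponential is then at least \<open>exp (- 1)\<close>, and the
  factor \<open>exp 1\<close> makes up for it.\<close>

lemma edge_mass_le_tail_functional:
  assumes \<nu>: "\<omega> t \<in> finite_borel_measures" and u: "0 < u" and \<epsilon>: "0 < \<epsilon>"
    and X: "(\<lambda>x. X \<omega> t x) \<in> borel_measurable borel" "\<omega> t = density lborel (\<lambda>x. ennreal (X \<omega> t x))"
  shows "edge_mass X \<epsilon> u t \<omega> \<le> ennreal (exp 1) * tail_functional (\<omega> t) u (2 * u) (1 / \<epsilon>)"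
proof -
  interpret finite_measure "\<omega> t" by (rule finite_borel_measuresD[OF \<nu>])
  have sets [measurable_cong, simp]: "sets (\<omega> t) = sets borel" by (rule finite_borel_measuresD[OF \<nu>])
  note [measurable] = X(1)
  let ?S = "{x. right_edge \<epsilon> \<omega> t - ereal u \<le> ereal x}"
  let ?g = "\<lambda>y. exp (- (1 / \<epsilon> * measure (\<omega> t) {of_int \<lfloor>y / u\<rfloor> * u + 2 * u..}))"
  have [measurable]: "?g \<in> borel_measurable borel"
    using measurable_compose[OF floor_measurable[of u], of "\<lambda>j. exp (- (1 / \<epsilon> * measure (\<omega> t) {of_int j * u + 2 * u..}))" borel] by simp
  have pt: "indicator ?S y \<le> ennreal (exp 1) * ennreal (?g y)" for y
  proof (cases "y \<in> ?S")
    case True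
    let ?z = "of_int \<lfloor>y / u\<rfloor> * u + 2 * u"
    \<comment> \<open>Rounding down on the mesh \<open>u\<close> loses strictly less than
      \<open>u\<close>. The resulting strict inequality yields a point of the defining set below
      \<open>?z\<close>, whether or not the infimum is attained.\<close>
    have "y < (of_int \<lfloor>y / u\<rfloor> + 1) * u"
      using u mult_strict_right_mono[OF real_of_int_floor_add_one_gt[of "y / u"], of u] by simp
    then have "y + u < ?z" by (simp add: algebra_simps)
    \<comment> \<open>This includes an edge at \<open>- \<infinity>\<close>, for which every point
      lies in \<open>?S\<close>; an edge at \<open>\<infinity>\<close> is excluded by
      membership.\<close>
    moreover have "right_edge \<epsilon> \<omega> t \<le> ereal (y + u)"
      using True by (cases "right_edge \<epsilon> \<omega> t") auto
    ultimately have "right_edge \<epsilon> \<omega> t < ereal ?z"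
      by (meson less_ereal.simps(1) order_le_less_trans)
    then obtain x where x: "measure (\<omega> t) {x..} < \<epsilon>" "x < ?z"
      unfolding right_edge_def by (auto simp: Inf_less_iff)
    have "measure (\<omega> t) {?z..} \<le> measure (\<omega> t) {x..}"
      using x by (intro finite_measure_mono) auto
    then have "1 / \<epsilon> * measure (\<omega> t) {?z..} \<le> 1"
      using x \<epsilon> by (simp add: pos_divide_le_eq)
    then have "1 \<le> exp 1 * ?g y"
      by (simp add: exp_add[symmetric])
    then show ?thesis
      using True by (simp add: ennreal_mult[symmetric])
  qed simp
  have "edge_mass X \<epsilon> u t \<omega> = (\<integral>\<^sup>+x. ennreal (X \<omega> t x) * indicator ?S x \<partial>lborel)"
    by (simp add: edge_mass_def)
  also have "\<dots> = (\<integral>\<^sup>+x. indicator ?S x \<partial>density lborel (\<lambda>x. ennreal (X \<omega> t x)))"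
    by (rule nn_integral_density[symmetric]) measurable
  also have "\<dots> = (\<integral>\<^sup>+x. indicator ?S x \<partial>\<omega> t)"
    by (simp flip: X(2))
  also have "\<dots> \<le> (\<integral>\<^sup>+y. ennreal (exp 1) * ennreal (?g y) \<partial>\<omega> t)"
    by (intro nn_integral_mono pt)
  also have "\<dots> = ennreal (exp 1) * tail_functional (\<omega> t) u (2 * u) (1 / \<epsilon>)"
    unfolding tail_functional_def by (rule nn_integral_cmult) measurable
  finally show ?thesis .
qed

lemma density_field_edge_mass:
  assumes X: "density_field M X" and t: "0 < t" and \<epsilon>: "0 < \<epsilon>" and u: "0 < u"
    and fin: "\<And>\<omega>. \<omega> \<in> space M \<Longrightarrow> \<omega> t \<in> finite_borel_measures"
  shows "AE \<omega> in M. edge_mass X \<epsilon> u t \<omega> \<le> ennreal (exp 1) * tail_functional (\<omega> t) u (2 * u) (1 / \<epsilon>)"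
  using X[unfolded density_field_def] AE_space
proof eventually_elim
  case (elim \<omega>)
  have "continuous_on UNIV ((\<lambda>(t, x). X \<omega> t x) \<circ> Pair t)"
    by (rule continuous_on_compose[OF _ continuous_on_subset[OF conjunct1[OF elim(1)]]])
       (use t in \<open>auto intro!: continuous_intros\<close>)
  then have "(\<lambda>x. X \<omega> t x) \<in> borel_measurable borel"
    by (intro borel_measurable_continuous_onI) (simp add: o_def)
  then show ?case
    using elim t by (intro edge_mass_le_tail_functional fin u \<epsilon>) auto
qed


subsection \<open>Canonical measures and super-Brownian motion\<close>

text \<open>The Laplace formula expresses the solution at a positive time as an integral that
  increases with the test function, so monotonicity of solutions comes from the measure
  itself.\<close>

lemma canonical_superprocess_marginals:
  assumes N: "canonical_measures N"
  shows "superprocess_marginals (N x) (\<lambda>t \<omega>. \<omega> t) (\<lambda>f. ennreal (f x)) 1"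
proof
  have sets: "sets (N x) = sets path_space" for x using N by (simp add: canonical_measures_def)
  have laplace: "(\<integral>\<^sup>+\<omega>. ennreal (1 - exp (- (LINT y|\<omega> t. \<phi> y))) \<partial>N x) = ennreal (V t x)"
    if \<phi>: "test_function \<phi>" and V: "mild \<phi> V" and t: "0 < t" for \<phi> V t x
  proof -
    obtain W where W: "log_laplace_solution \<phi> W"
      "\<And>t x. 0 < t \<Longrightarrow> (\<integral>\<^sup>+\<nu>. ennreal (1 - exp (- (LINT y|\<nu> t. \<phi> y))) \<partial>N x) = ennreal (W t x)"
      using N \<phi> unfolding canonical_measures_def by blast
    show ?thesis using W(2)[OF t] log_laplace_mild_eq[OF \<phi> W(1) V] t by simp
  qed
  have meas: "(\<lambda>\<omega>. \<omega> t) \<in> N x \<rightarrow>\<^sub>M weak_borel" if "0 < t" for t x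
    using measurable_path_eval[of t] that by (subst measurable_cong_sets[OF sets refl]) auto
  then show "(\<lambda>\<omega>. \<omega> t) \<in> N x \<rightarrow>\<^sub>M weak_borel" if "0 < t" for t using that .
  show "(\<integral>\<^sup>+\<omega>. ennreal (1 - exp (- (LINT y|\<omega> t. \<phi> y))) \<partial>N x) = ennreal (V t x)"
    if "test_function \<phi>" "mild \<phi> V" "0 < t" for \<phi> V t
    using laplace[OF that] .
  show "\<exists>V. mild \<phi> V" if \<phi>: "test_function \<phi>" for \<phi>
    using N \<phi> mild_of_log_laplace_solution[OF _ \<phi>] unfolding canonical_measures_def by blast
  show "V t y \<le> W t y" if \<phi>: "test_function \<phi>" and \<psi>: "test_function \<psi>" and le: "\<And>x. \<phi> x \<le> \<psi> x"
    and V: "mild \<phi> V" and W: "mild \<psi> W" and t: "0 \<le> t" for \<phi> \<psi> V W t y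
  proof (cases "t = 0")
    case True
    then show ?thesis
      using mild_initial[OF V, of y] mild_initial[OF W, of y] \<phi> \<psi> le by (simp add: test_function_def)
  next
    case False
    with t have t: "0 < t" by simp
    have "ennreal (V t y) \<le> ennreal (W t y)"
      unfolding laplace[OF \<phi> V t, symmetric] laplace[OF \<psi> W t, symmetric]
    proof (intro nn_integral_mono ennreal_leI)
      fix \<omega> assume "\<omega> \<in> space (N y)"
      then have "\<omega> t \<in> finite_borel_measures"
        using measurable_space[OF meas[OF t]] by (simp add: space_weak_borel)
      then show "1 - exp (- (LINT x|\<omega> t. \<phi> x)) \<le> 1 - exp (- (LINT x|\<omega> t. \<psi> x))"
        using integral_test_function_mono[OF _ \<phi> \<psi> le] by simp
    qed
    then show ?thesis using mild_nonneg[OF W] by (subst (asm) ennreal_le_iff) auto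
  qed
qed (auto intro: ennreal_leI)

section \<open>Marginals of super-Brownian motion\<close>

lemma prob_algebra_weak_borelD:
  assumes "R \<in> space (prob_algebra weak_borel)"
  shows "prob_space R" "sets R = sets weak_borel"
  using assms by (auto simp: space_prob_algebra)

text \<open>The Markov property is taken at time \<open>0\<close>, where the path is almost surely
  at \<open>X0\<close>; integrating the conditional expectation gives the law at time
  \<open>t\<close>.\<close>

lemma super_brownian_marginal:
  assumes P: "super_brownian_law X0 P" and X0: "X0 \<in> finite_borel_measures"
  obtains Q where "super_brownian_transition Q" "\<And>t. 0 \<le> t \<Longrightarrow> distr P weak_borel (\<lambda>\<omega>. \<omega> t) = Q t X0"
proof -
  obtain Q where Q: "super_brownian_transition Q" and
    markov: "\<And>s t B. 0 \<le> s \<Longrightarrow> 0 \<le> t \<Longrightarrow> B \<in> sets weak_borel \<Longrightarrow>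
      AE \<omega> in P. real_cond_exp P (past P s) (\<lambda>\<omega>. indicator B (\<omega> (s + t))) \<omega> = measure (Q t (\<omega> s)) B"
    using P unfolding super_brownian_law_def by blast
  interpret prob_space P using P by (simp add: super_brownian_law_def)
  have sets: "sets P = sets path_space" and init: "AE \<omega> in P. \<omega> 0 = X0"
    using P by (auto simp: super_brownian_law_def)
  have eval: "(\<lambda>\<omega>. \<omega> t) \<in> P \<rightarrow>\<^sub>M weak_borel" if "0 \<le> t" for t
    using measurable_path_eval[OF that] by (subst measurable_cong_sets[OF sets refl])
  \<comment> \<open>The facts on \<open>real_cond_exp\<close> need the past to be a
    sub-sigma-algebra, which follows from measurability of restricting paths.\<close>
  have "subalgebra P (past P s)" for s
  proof -
    have f: "(\<lambda>\<omega>. restrict \<omega> {0..s}) \<in> P \<rightarrow>\<^sub>M PiM {0..s} (\<lambda>_. weak_borel)"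
      by (rule measurable_restrict) (auto intro: eval)
    then have "(\<lambda>\<omega>. restrict \<omega> {0..s}) \<in> space P \<rightarrow> space (PiM {0..s} (\<lambda>_. weak_borel))"
      by (blast dest: measurable_space)
    from sets_vimage_algebra2[OF this] show ?thesis
      unfolding subalgebra_def past_def using measurable_sets[OF f] by auto
  qed
  from this[of 0] interpret finite_measure_subalgebra P "past P 0"
    by (simp add: finite_measure_subalgebra_def finite_measure_subalgebra_axioms_def finite_measure_axioms)
  have "distr P weak_borel (\<lambda>\<omega>. \<omega> t) = Q t X0" if t: "0 \<le> t" for t
  proof (rule measure_eqI)
    have "Q t \<in> weak_borel \<rightarrow>\<^sub>M prob_algebra weak_borel"
      using Q t by (simp add: super_brownian_transition_def)
    then have Qt: "Q t X0 \<in> space (prob_algebra weak_borel)"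
      using X0 by (auto dest: measurable_space simp: space_weak_borel)
    note [simp] = prob_algebra_weak_borelD(2)[OF Qt]
    interpret Q: prob_space "Q t X0" by (rule prob_algebra_weak_borelD[OF Qt])
    show "sets (distr P weak_borel (\<lambda>\<omega>. \<omega> t)) = sets (Q t X0)" by simp
    fix B assume "B \<in> sets (distr P weak_borel (\<lambda>\<omega>. \<omega> t))"
    then have B: "B \<in> sets weak_borel" by simp
    have int: "integrable P (\<lambda>\<omega>. indicator B (\<omega> t) :: real)"
      using measurable_compose[OF eval[OF t] borel_measurable_indicator[OF B]]
      by (intro integrable_const_bound[of _ 1]) (auto simp: indicator_def)
    let ?E = "(\<lambda>\<omega>. \<omega> t) -` B \<inter> space P"
    have [measurable]: "?E \<in> sets P" by (rule measurable_sets[OF eval[OF t] B])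
    have "measure P ?E = (LINT \<omega>|P. indicator ?E \<omega>)" by simp
    also have "\<dots> = (LINT \<omega>|P. indicator B (\<omega> t))"
      by (intro Bochner_Integration.integral_cong) (auto simp: indicator_def)
    also have "\<dots> = (LINT \<omega>|P. real_cond_exp P (past P 0) (\<lambda>\<omega>. indicator B (\<omega> t)) \<omega>)"
      using int by (rule real_cond_exp_int(2)[symmetric])
    also have "\<dots> = (LINT \<omega>|P. measure (Q t X0) B)"
      using markov[OF order_refl t B] init
      by (intro integral_cong_AE) (auto elim: eventually_elim2)
    also have "\<dots> = measure (Q t X0) B" by (simp add: prob_space)
    finally show "emeasure (distr P weak_borel (\<lambda>\<omega>. \<omega> t)) B = emeasure (Q t X0) B"
      by (simp add: emeasure_distr[OF eval[OF t] B] emeasure_eq_measure Q.emeasure_eq_measure)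
  qed
  with Q show ?thesis by (rule that)
qed

text \<open>The inequality \<open>1 - exp (- x) \<le> x\<close> gives the linear bound on
  \<open>G\<close>. Comparison of solutions is obtained from the transition kernel started at point
  masses.\<close>

lemma super_brownian_superprocess_marginals:
  assumes P: "super_brownian_law X0 P" and X0: "X0 \<in> finite_borel_measures"
  shows "superprocess_marginals P (\<lambda>t \<omega>. \<omega> t) (\<lambda>f. ennreal (1 - exp (- (LINT x|X0. f x)))) (measure X0 UNIV)"
proof -
  obtain Q where Q: "super_brownian_transition Q" and
    marginal: "\<And>t. 0 \<le> t \<Longrightarrow> distr P weak_borel (\<lambda>\<omega>. \<omega> t) = Q t X0"
    using super_brownian_marginal[OF P X0] by blast
  interpret prob_space P using P by (simp add: super_brownian_law_def)
  interpret X0: finite_measure X0 by (rule finite_borel_measuresD[OF X0])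
  have eval: "(\<lambda>\<omega>. \<omega> t) \<in> P \<rightarrow>\<^sub>M weak_borel" if "0 \<le> t" for t
    using measurable_path_eval[OF that] P by (subst measurable_cong_sets[OF _ refl]) (auto simp: super_brownian_law_def)
  have laplace: "(LINT \<nu>|Q t \<mu>. exp (- (LINT x|\<nu>. \<phi> x))) = exp (- (LINT x|\<mu>. V t x))"
    if \<phi>: "test_function \<phi>" and V: "mild \<phi> V" and t: "0 \<le> t" and \<mu>: "\<mu> \<in> finite_borel_measures" for \<phi> V t \<mu>
  proof -
    obtain W where W: "log_laplace_solution \<phi> W"
      "\<And>t \<mu>. 0 \<le> t \<Longrightarrow> \<mu> \<in> finite_borel_measures \<Longrightarrow> (LINT \<nu>|Q t \<mu>. exp (- (LINT x|\<nu>. \<phi> x))) = exp (- (LINT x|\<mu>. W t x))"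
      using Q \<phi> unfolding super_brownian_transition_def by blast
    show ?thesis using W(2)[OF t \<mu>] log_laplace_mild_eq[OF \<phi> W(1) V t] by simp
  qed
  have integrable_exp: "integrable R (\<lambda>\<nu>. exp (- (LINT x|\<nu>. \<phi> x)))"
    if "prob_space R" and R: "sets R = sets weak_borel" and \<phi>: "test_function \<phi>" for R \<phi>
  proof -
    interpret R: prob_space R by fact
    have "(\<lambda>\<nu>. LINT x|\<nu>. \<phi> x) \<in> borel_measurable R"
      using measurable_weak_borel_integral[OF \<phi>] R by (subst measurable_cong_sets[OF R refl])
    then show ?thesis
      using \<phi> by (intro R.integrable_const_bound[of _ 1]) (auto simp: test_function_def intro!: integral_nonneg_AE)
  qed
  show ?thesis
  proof
    show "(\<lambda>\<omega>. \<omega> t) \<in> P \<rightarrow>\<^sub>M weak_borel" if "0 < t" for t using eval that by simp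
    show "(\<integral>\<^sup>+\<omega>. ennreal (1 - exp (- (LINT x|\<omega> t. \<phi> x))) \<partial>P) = ennreal (1 - exp (- (LINT x|X0. V t x)))"
      if \<phi>: "test_function \<phi>" and V: "mild \<phi> V" and t: "0 < t" for \<phi> V t
    proof -
      let ?D = "distr P weak_borel (\<lambda>\<omega>. \<omega> t)"
      have meas: "(\<lambda>\<omega>. LINT x|\<omega> t. \<phi> x) \<in> borel_measurable P"
        using measurable_compose[OF eval measurable_weak_borel_integral[OF \<phi>]] t by simp
      have nn: "0 \<le> (LINT x|\<nu>. \<phi> x)" for \<nu> using \<phi> by (auto simp: test_function_def intro!: integral_nonneg_AE)
      have int: "integrable P (\<lambda>\<omega>. exp (- (LINT x|\<omega> t. \<phi> x)))"
        using meas nn by (intro integrable_const_bound[of _ 1]) auto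
      have "(\<integral>\<^sup>+\<omega>. ennreal (1 - exp (- (LINT x|\<omega> t. \<phi> x))) \<partial>P) = ennreal (LINT \<omega>|P. 1 - exp (- (LINT x|\<omega> t. \<phi> x)))"
        using int nn by (intro nn_integral_eq_integral) auto
      also have "(LINT \<omega>|P. 1 - exp (- (LINT x|\<omega> t. \<phi> x))) = 1 - (LINT \<omega>|P. exp (- (LINT x|\<omega> t. \<phi> x)))"
        using int by (simp add: prob_space)
      also have "(LINT \<omega>|P. exp (- (LINT x|\<omega> t. \<phi> x))) = (LINT \<nu>|?D. exp (- (LINT x|\<nu>. \<phi> x)))"
        using measurable_weak_borel_integral[OF \<phi>] eval t by (intro integral_distr[symmetric]) auto
      also have "\<dots> = exp (- (LINT x|X0. V t x))"
        using marginal[of t] laplace[OF \<phi> V _ X0, of t] t by simp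
      finally show ?thesis .
    qed
    show "\<exists>V. mild \<phi> V" if \<phi>: "test_function \<phi>" for \<phi>
      using Q \<phi> mild_of_log_laplace_solution[OF _ \<phi>] unfolding super_brownian_transition_def by blast
    show "V t y \<le> W t y" if \<phi>: "test_function \<phi>" and \<psi>: "test_function \<psi>" and le: "\<And>x. \<phi> x \<le> \<psi> x"
      and V: "mild \<phi> V" and W: "mild \<psi> W" and t: "0 \<le> t" for \<phi> \<psi> V W t y
    proof -
      \<comment> \<open>Started from a unit mass at \<open>y\<close>, the transition law has Laplace
        functional \<open>exp (- V t y)\<close>, which decreases as the test function grows; so
        larger test functions give larger solutions.\<close>
      let ?\<mu> = "return borel y"
      have \<mu>: "?\<mu> \<in> finite_borel_measures"
        by (auto simp: finite_borel_measures_def intro!: prob_space.finite_measure prob_space_return)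
      have "Q t \<in> weak_borel \<rightarrow>\<^sub>M prob_algebra weak_borel"
        using Q t by (simp add: super_brownian_transition_def)
      then have "Q t ?\<mu> \<in> space (prob_algebra weak_borel)"
        using \<mu> by (auto dest: measurable_space simp: space_weak_borel)
      note R = prob_algebra_weak_borelD[OF this]
      have "exp (- W t y) = (LINT \<nu>|Q t ?\<mu>. exp (- (LINT x|\<nu>. \<psi> x)))"
        using laplace[OF \<psi> W t \<mu>] mild_measurable'[OF W, of t] by (simp add: integral_return)
      also have "\<dots> \<le> (LINT \<nu>|Q t ?\<mu>. exp (- (LINT x|\<nu>. \<phi> x)))"
      proof (intro integral_mono integrable_exp R \<phi> \<psi>)
        fix \<nu> assume "\<nu> \<in> space (Q t ?\<mu>)"
        then have "\<nu> \<in> finite_borel_measures"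
          using sets_eq_imp_space_eq[OF R(2)] by (simp add: space_weak_borel)
        then show "exp (- (LINT x|\<nu>. \<psi> x)) \<le> exp (- (LINT x|\<nu>. \<phi> x))"
          using integral_test_function_mono[OF _ \<phi> \<psi> le] by simp
      qed
      also have "\<dots> = exp (- V t y)"
        using laplace[OF \<phi> V t \<mu>] mild_measurable'[OF V, of t] by (simp add: integral_return)
      finally show ?thesis by simp
    qed
    show "ennreal (1 - exp (- (LINT x|X0. f x))) \<le> ennreal (measure X0 UNIV * c)"
      if f: "f \<in> borel_measurable borel" "\<And>x. 0 \<le> f x" "\<And>x. f x \<le> c" for f c
    proof (rule ennreal_leI)
      have "1 - exp (- (LINT x|X0. f x)) \<le> (LINT x|X0. f x)"
        using exp_ge_add_one_self[of "- (LINT x|X0. f x)"] by simp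
      also have "\<dots> \<le> (LINT x|X0. c)"
        using f order_trans[OF f(2) f(3)]
        by (intro integral_mono integrable_test_function[OF X0 test_functionI]) auto
      also have "\<dots> = measure X0 UNIV * c"
        using finite_borel_measuresD[OF X0] by simp
      finally show "1 - exp (- (LINT x|X0. f x)) \<le> measure X0 UNIV * c" .
    qed
  qed simp
qed

theorem proposition1p5:
  shows "\<exists>c :: real \<Rightarrow> real.
    antimono_on {0<..} c \<and> (\<forall>t>0. 0 < c t) \<and>
    (\<forall>t>0. \<forall>\<epsilon>>0. \<forall>u>0.
      (\<forall>X0\<in>finite_borel_measures. \<forall>P X. super_brownian_law X0 P \<and> density_field P X \<longrightarrow>
        (\<integral>\<^sup>+\<omega>. edge_mass X \<epsilon> u t \<omega> \<partial>P)
          \<le> ennreal (c t * measure X0 UNIV * max (u\<^sup>2) \<epsilon>)) \<and>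
      (\<forall>N X. canonical_measures N \<and> density_field (N 0) X \<longrightarrow>
        (\<integral>\<^sup>+\<omega>. edge_mass X \<epsilon> u t \<omega> \<partial>N 0)
          \<le> ennreal (c t * max (u\<^sup>2) \<epsilon>)))"
proof -
  \<comment> \<open>Any \<open>A\<close> with \<open>A\<^sup>2 \<ge> 48 / gauss_tail 2\<close> will
    do; the successor ensures \<open>A \<ge> 1\<close>, so that
    \<open>A \<le> A\<^sup>2\<close>.\<close>
  obtain A0 where A0: "48 / gauss_tail 2 \<le> real A0" using real_arch_simple by blast
  define A where "A = Suc A0"
  have A: "1 \<le> A" by (simp add: A_def)
  have "48 / gauss_tail 2 \<le> (real A)\<^sup>2"
    using A0 power_increasing[of 1 2 "real A"] by (simp add: A_def)
  then have A': "48 \<le> gauss_tail 2 * (real A)\<^sup>2"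
    using gauss_tail_pos[of 2] by (simp add: pos_divide_le_eq mult.commute)
  \<comment> \<open>The dependence on \<open>t\<close> is through the factor \<open>1 / t\<close>
    alone, which makes \<open>c\<close> non-increasing.\<close>
  define c where "c t = 32 * exp 1 / gauss_tail (real A + 2) / t" for t :: real
  have "antimono_on {0<..} c"
    using gauss_tail_pos[of "real A + 2"] by (auto simp: c_def monotone_on_def intro!: divide_left_mono)
  moreover have "0 < c t" if "0 < t" for t
    using gauss_tail_pos[of "real A + 2"] that by (simp add: c_def)
  moreover have "(\<integral>\<^sup>+\<omega>. edge_mass X \<epsilon> u t \<omega> \<partial>P) \<le> ennreal (c t * measure X0 UNIV * max (u\<^sup>2) \<epsilon>)"
    if t: "0 < t" and \<epsilon>: "0 < \<epsilon>" and u: "0 < u" and X0: "X0 \<in> finite_borel_measures" and P: "super_brownian_law X0 P"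
    and X: "density_field P X" for t \<epsilon> u X0 P X
  proof -
    interpret superprocess_marginals P "\<lambda>t \<omega>. \<omega> t" "\<lambda>f. ennreal (1 - exp (- (LINT x|X0. f x)))" "measure X0 UNIV"
      by (rule super_brownian_superprocess_marginals[OF P X0])
    show ?thesis
      unfolding c_def by (intro edge_mass_bound A A' t \<epsilon> u density_field_edge_mass X Y_finite)
  qed
  moreover have "(\<integral>\<^sup>+\<omega>. edge_mass X \<epsilon> u t \<omega> \<partial>N 0) \<le> ennreal (c t * max (u\<^sup>2) \<epsilon>)"
    if t: "0 < t" and \<epsilon>: "0 < \<epsilon>" and u: "0 < u" and N: "canonical_measures N"
    and X: "density_field (N 0) X" for t \<epsilon> u N X
  proof -
    interpret superprocess_marginals "N 0" "\<lambda>t \<omega>. \<omega> t" "\<lambda>f. ennreal (f 0)" 1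
      by (rule canonical_superprocess_marginals[OF N])
    have "(\<integral>\<^sup>+\<omega>. edge_mass X \<epsilon> u t \<omega> \<partial>N 0) \<le> ennreal (c t * 1 * max (u\<^sup>2) \<epsilon>)"
      unfolding c_def by (intro edge_mass_bound A A' t \<epsilon> u density_field_edge_mass X Y_finite)
    then show ?thesis by simp
  qed
  ultimately show ?thesis by blast
qed

end
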